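(* Let $0 < \varepsilon < 1$. Given a pair $(X, C)$ consisting of a set $X \subset \mathbb{R}^d$ of $n$ points (presented as a stream) and a set $C$ of $k$ centers, there is a single-pass streaming algorithm which builds an edge-weighted bipartite graph $G$ representing the pair $(X, C)$. The space used by this algorithm (including the size of $G$) is $O\left((k + \log n)\cdot\left(k \cdot 6^k \cdot \log\Delta + k^k \cdot \log^k(\tfrac{1}{\varepsilon})\right)\right)$, where $\Delta = \frac{\max_{p \in X, c \in C}\|p - c\|}{\min_{p \in X \setminus C, c \in C}\|p - c\|}$.
   Context: Let $G = (V, E)$ be an edge-weighted bipartite graph with sides $L$ and $R$, with a number $n_v$ attached to each $v \in L$. $G$ represents the pair $(X, C)$ if: $R = C$; each point $p \in X$ is mapped to a unique vertex $\phi(p) \in L$ and $n_v = |\phi^{-1}(v)|$ for each $v \in L$; and for each $p \in X$ and $c \in C$, the weight of the edge $(\phi(p), c)$ is within a factor $(1 \pm \varepsilon)$ of $\|p - c\|^2$.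
   Formalization: The O-constant may depend on ε when log Δ and log(1/ε) are ordinary logarithms; it is uniform for ε ≤ ε₀ < 1 when these are taken to base 1+ε. A constant uniform in ε with ordinary logarithms is impossible. X∖C and C are nonempty. *)

theory Defs
  imports "HOL-Analysis.Analysis" "HOL-Library.Log_Nat"
begin

subsection \<open>Points, centers, and the ratio of distances\<close>

text \<open>The dimension is a value and not a type, so that one algorithm and one constant can serve
  all dimensions: a point of d-dimensional space is a list of d coordinates.\<close>

type_synonym point = "real list"

definition euclid :: "nat \<Rightarrow> point set" where
  "euclid d = {p. length p = d}"

definition edist :: "point \<Rightarrow> point \<Rightarrow> real" where
  "edist p c = L2_set (\<lambda>i. p ! i - c ! i) {..<length p}"

definition Delta :: "point set \<Rightarrow> point set \<Rightarrow> real" where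
  "Delta X C = Max {edist p c | p c. p \<in> X \<and> c \<in> C} / Min {edist p c | p c. p \<in> X - C \<and> c \<in> C}"

text \<open>Non-emptiness of \<open>C\<close> and \<open>X - C\<close> is what makes the maximum and the minimum in
  \<^const>\<open>Delta\<close> meaningful.\<close>

definition points_and_centers :: "nat \<Rightarrow> nat \<Rightarrow> nat \<Rightarrow> point set \<Rightarrow> point set \<Rightarrow> bool" where
  "points_and_centers d n k X C \<longleftrightarrow>
     X \<subseteq> euclid d \<and> finite X \<and> card X = n \<and>
     C \<subseteq> euclid d \<and> finite C \<and> card C = k \<and> C \<noteq> {} \<and> X - C \<noteq> {}"

subsection \<open>Weighted bipartite graphs representing a pair\<close>

record ('l, 'r) wbigraph =
  left :: "'l set"
  right :: "'r set"
  edges :: "('l \<times> 'r) set"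
  weight :: "'l \<times> 'r \<Rightarrow> real"
  num :: "'l \<Rightarrow> nat"

definition wf_wbigraph :: "('l, 'r) wbigraph \<Rightarrow> bool" where
  "wf_wbigraph G \<longleftrightarrow> finite (left G) \<and> finite (right G) \<and> edges G \<subseteq> left G \<times> right G"

definition represents :: "real \<Rightarrow> ('l, point) wbigraph \<Rightarrow> point set \<Rightarrow> point set \<Rightarrow> bool" where
  "represents \<epsilon> G X C \<longleftrightarrow>
     wf_wbigraph G \<and> right G = C \<and>
     (\<exists>\<phi>. (\<forall>p\<in>X. \<phi> p \<in> left G) \<and>
          (\<forall>v\<in>left G. num G v = card {p \<in> X. \<phi> p = v}) \<and>
          (\<forall>p\<in>X. \<forall>c\<in>C. (\<phi> p, c) \<in> edges G \<and>
             (1 - \<epsilon>) * (edist p c)\<^sup>2 \<le> weight G (\<phi> p, c) \<and>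
             weight G (\<phi> p, c) \<le> (1 + \<epsilon>) * (edist p c)\<^sup>2))"

subsection \<open>Streaming algorithms on a real RAM\<close>

text \<open>
  Streaming algorithms are programs for a real RAM.  The memory consists of an array of natural
  numbers and an array of real numbers.  The centers, the accuracy and the point of the
  stream currently being processed are read-only inputs; the points are accessible only through
  their squared distances to the centers.  A natural number is charged its number of bits, a real
  number is charged one unit.

  Programs are syntactic objects with field operations and comparisons as the only operations on
  reals.  If steps were arbitrary functions on memories, then one real number could encode the whole
  stream and the space measure would be meaningless.
\<close>

datatype nexp =
    NConst nat
  | NLoad nexp
  | NumCenters
  | NAdd nexp nexp
  | NSub nexp nexp
  | NMul nexp nexp

datatype rexp =
    ROfNat nexp
  | RLoad nexp
  | Eps
  | SqDist nexp
  | RAdd rexp rexp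
  | RSub rexp rexp
  | RMul rexp rexp
  | RDiv rexp rexp

datatype bexp =
    NLess nexp nexp
  | RLess rexp rexp
  | Not bexp
  | And bexp bexp

datatype com =
    Skip
  | NStore nexp nexp
  | RStore nexp rexp
  | Seq com com
  | If bexp com com
  | While bexp com

record env =
  centers :: "point list"
  eps :: real
  current :: "point option"

record state =
  nats :: "nat list"
  reals :: "real list"
  peak :: nat

definition fetch :: "'a::zero list \<Rightarrow> nat \<Rightarrow> 'a" where
  "fetch xs i = (if i < length xs then xs ! i else 0)"

text \<open>Storing beyond the end of an array allocates, and hence pays for, all cells up to the
  address used; otherwise addresses could carry information for free.\<close>

definition store :: "'a::zero list \<Rightarrow> nat \<Rightarrow> 'a \<Rightarrow> 'a list" where
  "store xs i x = (if i < length xs then xs[i := x] else xs @ replicate (i - length xs) 0 @ [x])"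

definition bits :: "nat \<Rightarrow> nat" where
  "bits m = max 1 (floorlog 2 m)"

definition space :: "state \<Rightarrow> nat" where
  "space \<sigma> = sum_list (map bits (nats \<sigma>)) + length (reals \<sigma>)"

text \<open>The field \<^const>\<open>peak\<close> is not accessible to programs; it records the largest amount of
  space used so far.\<close>

definition touch :: "state \<Rightarrow> state" where
  "touch \<sigma> = \<sigma>\<lparr>peak := max (peak \<sigma>) (space \<sigma>)\<rparr>"

definition empty_state :: state where
  "empty_state = \<lparr>nats = [], reals = [], peak = 0\<rparr>"

fun nval :: "env \<Rightarrow> state \<Rightarrow> nexp \<Rightarrow> nat" where
  "nval \<Gamma> \<sigma> (NConst m) = m"
| "nval \<Gamma> \<sigma> (NLoad a) = fetch (nats \<sigma>) (nval \<Gamma> \<sigma> a)"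
| "nval \<Gamma> \<sigma> NumCenters = length (centers \<Gamma>)"
| "nval \<Gamma> \<sigma> (NAdd a b) = nval \<Gamma> \<sigma> a + nval \<Gamma> \<sigma> b"
| "nval \<Gamma> \<sigma> (NSub a b) = nval \<Gamma> \<sigma> a - nval \<Gamma> \<sigma> b"
| "nval \<Gamma> \<sigma> (NMul a b) = nval \<Gamma> \<sigma> a * nval \<Gamma> \<sigma> b"

fun rval :: "env \<Rightarrow> state \<Rightarrow> rexp \<Rightarrow> real" where
  "rval \<Gamma> \<sigma> (ROfNat a) = real (nval \<Gamma> \<sigma> a)"
| "rval \<Gamma> \<sigma> (RLoad a) = fetch (reals \<sigma>) (nval \<Gamma> \<sigma> a)"
| "rval \<Gamma> \<sigma> Eps = eps \<Gamma>"
| "rval \<Gamma> \<sigma> (SqDist a) =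
     (case current \<Gamma> of
        None \<Rightarrow> 0
      | Some p \<Rightarrow> (let j = nval \<Gamma> \<sigma> a in
                    if j < length (centers \<Gamma>) then (edist p (centers \<Gamma> ! j))\<^sup>2 else 0))"
| "rval \<Gamma> \<sigma> (RAdd a b) = rval \<Gamma> \<sigma> a + rval \<Gamma> \<sigma> b"
| "rval \<Gamma> \<sigma> (RSub a b) = rval \<Gamma> \<sigma> a - rval \<Gamma> \<sigma> b"
| "rval \<Gamma> \<sigma> (RMul a b) = rval \<Gamma> \<sigma> a * rval \<Gamma> \<sigma> b"
| "rval \<Gamma> \<sigma> (RDiv a b) = rval \<Gamma> \<sigma> a / rval \<Gamma> \<sigma> b"

fun bval :: "env \<Rightarrow> state \<Rightarrow> bexp \<Rightarrow> bool" where
  "bval \<Gamma> \<sigma> (NLess a b) \<longleftrightarrow> nval \<Gamma> \<sigma> a < nval \<Gamma> \<sigma> b"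
| "bval \<Gamma> \<sigma> (RLess a b) \<longleftrightarrow> rval \<Gamma> \<sigma> a < rval \<Gamma> \<sigma> b"
| "bval \<Gamma> \<sigma> (Not a) \<longleftrightarrow> \<not> bval \<Gamma> \<sigma> a"
| "bval \<Gamma> \<sigma> (And a b) \<longleftrightarrow> bval \<Gamma> \<sigma> a \<and> bval \<Gamma> \<sigma> b"

inductive exec :: "env \<Rightarrow> com \<Rightarrow> state \<Rightarrow> state \<Rightarrow> bool" for \<Gamma> where
  Skip: "exec \<Gamma> Skip \<sigma> \<sigma>"
| NStore: "exec \<Gamma> (NStore a b) \<sigma>
     (touch (\<sigma>\<lparr>nats := store (nats \<sigma>) (nval \<Gamma> \<sigma> a) (nval \<Gamma> \<sigma> b)\<rparr>))"
| RStore: "exec \<Gamma> (RStore a r) \<sigma>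
     (touch (\<sigma>\<lparr>reals := store (reals \<sigma>) (nval \<Gamma> \<sigma> a) (rval \<Gamma> \<sigma> r)\<rparr>))"
| Seq: "exec \<Gamma> c1 \<sigma> \<sigma>' \<Longrightarrow> exec \<Gamma> c2 \<sigma>' \<sigma>'' \<Longrightarrow> exec \<Gamma> (Seq c1 c2) \<sigma> \<sigma>''"
| IfTrue: "bval \<Gamma> \<sigma> b \<Longrightarrow> exec \<Gamma> c1 \<sigma> \<sigma>' \<Longrightarrow> exec \<Gamma> (If b c1 c2) \<sigma> \<sigma>'"
| IfFalse: "\<not> bval \<Gamma> \<sigma> b \<Longrightarrow> exec \<Gamma> c2 \<sigma> \<sigma>' \<Longrightarrow> exec \<Gamma> (If b c1 c2) \<sigma> \<sigma>'"
| WhileFalse: "\<not> bval \<Gamma> \<sigma> b \<Longrightarrow> exec \<Gamma> (While b c) \<sigma> \<sigma>"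
| WhileTrue: "bval \<Gamma> \<sigma> b \<Longrightarrow> exec \<Gamma> c \<sigma> \<sigma>' \<Longrightarrow> exec \<Gamma> (While b c) \<sigma>' \<sigma>'' \<Longrightarrow>
     exec \<Gamma> (While b c) \<sigma> \<sigma>''"

inductive_cases SkipE: "exec \<Gamma> Skip \<sigma> \<sigma>'"
inductive_cases NStoreE: "exec \<Gamma> (NStore a b) \<sigma> \<sigma>'"
inductive_cases RStoreE: "exec \<Gamma> (RStore a r) \<sigma> \<sigma>'"
inductive_cases SeqE: "exec \<Gamma> (Seq c1 c2) \<sigma> \<sigma>'"
inductive_cases IfE: "exec \<Gamma> (If b c1 c2) \<sigma> \<sigma>'"
inductive_cases WhileE: "exec \<Gamma> (While b c) \<sigma> \<sigma>'"

lemma exec_deterministic: "exec \<Gamma> c \<sigma> \<sigma>\<^sub>1 \<Longrightarrow> exec \<Gamma> c \<sigma> \<sigma>\<^sub>2 \<Longrightarrow> \<sigma>\<^sub>1 = \<sigma>\<^sub>2"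
proof (induction arbitrary: \<sigma>\<^sub>2 rule: exec.induct)
  case Skip
  then show ?case by (blast elim: SkipE)
next
  case NStore
  then show ?case by (blast elim: NStoreE)
next
  case RStore
  then show ?case by (blast elim: RStoreE)
next
  case Seq
  then show ?case by (blast elim: SeqE)
next
  case IfTrue
  then show ?case by (blast elim: IfE)
next
  case IfFalse
  then show ?case by (blast elim: IfE)
next
  case WhileFalse
  then show ?case by (blast elim: WhileE)
next
  case WhileTrue
  from WhileTrue.prems show ?case
    by (rule WhileE) (use WhileTrue.hyps WhileTrue.IH in blast)+
qed

record streaming_algorithm =
  initialize :: com
  update :: com
  finalize :: com

inductive feed :: "env \<Rightarrow> com \<Rightarrow> point list \<Rightarrow> state \<Rightarrow> state \<Rightarrow> bool" for \<Gamma> c where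
  "feed \<Gamma> c [] \<sigma> \<sigma>"
| "exec (\<Gamma>\<lparr>current := Some p\<rparr>) c \<sigma> \<sigma>' \<Longrightarrow> feed \<Gamma> c ps \<sigma>' \<sigma>'' \<Longrightarrow> feed \<Gamma> c (p # ps) \<sigma> \<sigma>''"

definition single_pass ::
    "streaming_algorithm \<Rightarrow> real \<Rightarrow> point list \<Rightarrow> point list \<Rightarrow> state \<Rightarrow> bool" where
  "single_pass A \<epsilon> cs xs \<sigma> \<longleftrightarrow>
     (let \<Gamma> = \<lparr>centers = cs, eps = \<epsilon>, current = None\<rparr> in
      \<exists>\<sigma>\<^sub>1 \<sigma>\<^sub>2. exec \<Gamma> (initialize A) empty_state \<sigma>\<^sub>1 \<and>
             feed \<Gamma> (update A) xs \<sigma>\<^sub>1 \<sigma>\<^sub>2 \<and>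
             exec \<Gamma> (finalize A) \<sigma>\<^sub>2 \<sigma>)"

text \<open>
  The output format: cells 0, 1 and 2 of the natural number array hold the number of left vertices,
  the address of the array of the numbers attached to them, and the address (in the array of reals)
  of the row-major matrix of edge weights.  Both arrays have to lie within the allocated memory, so
  the space of a run includes the size of the graph.
\<close>

definition graph_in_memory :: "point list \<Rightarrow> state \<Rightarrow> bool" where
  "graph_in_memory cs \<sigma> \<longleftrightarrow>
     3 \<le> length (nats \<sigma>) \<and>
     nats \<sigma> ! 1 + nats \<sigma> ! 0 \<le> length (nats \<sigma>) \<and>
     nats \<sigma> ! 2 + nats \<sigma> ! 0 * length cs \<le> length (reals \<sigma>)"

definition graph_of :: "point list \<Rightarrow> state \<Rightarrow> (nat, point) wbigraph" where
  "graph_of cs \<sigma> =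
     \<lparr>left = {..<nats \<sigma> ! 0},
      right = set cs,
      edges = {..<nats \<sigma> ! 0} \<times> set cs,
      weight = (\<lambda>(v, c). reals \<sigma> ! (nats \<sigma> ! 2 + v * length cs +
                                    (THE j. j < length cs \<and> cs ! j = c))),
      num = (\<lambda>v. nats \<sigma> ! (nats \<sigma> ! 1 + v))\<rparr>"

text \<open>The points of \<open>X\<close> may arrive, and the centers may be listed, in any order.\<close>

definition builds_representation ::
    "streaming_algorithm \<Rightarrow> real \<Rightarrow> point set \<Rightarrow> point set \<Rightarrow> real \<Rightarrow> bool" where
  "builds_representation A \<epsilon> X C S \<longleftrightarrow>
     (\<forall>xs cs. distinct xs \<and> set xs = X \<and> distinct cs \<and> set cs = C \<longrightarrow>
        (\<exists>\<sigma>. single_pass A \<epsilon> cs xs \<sigma> \<and> graph_in_memory cs \<sigma> \<and>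
             represents \<epsilon> (graph_of cs \<sigma>) X C \<and> real (peak \<sigma>) \<le> S))"

subsection \<open>The space bound\<close>

text \<open>
  The parameter \<open>b\<close> is the base of the logarithms of \<open>\<Delta>\<close> and \<open>1 / \<epsilon>\<close>, which count distance scales;
  \<open>log n\<close> is the number of bits of a counter.

  The base matters.  For small \<open>\<epsilon>\<close>, take one center and \<open>n\<close> points at distances \<open>(1 + \<epsilon>) ^ (2 * i)\<close> for
  \<open>i < n\<close>: no two points can share a vertex, so at least \<open>n\<close> vertices are needed, while
  \<open>log 2 \<Delta>\<close> is only of order \<open>n * \<epsilon>\<close>.  Hence with base 2 the constant of the bound has to depend on
  \<open>\<epsilon>\<close>, whereas a constant independent of \<open>\<epsilon>\<close> requires base \<open>1 + \<epsilon>\<close>, so that the logarithms count the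
  powers of \<open>1 + \<epsilon>\<close> in a range of distances.
\<close>

definition space_bound :: "real \<Rightarrow> real \<Rightarrow> nat \<Rightarrow> nat \<Rightarrow> real \<Rightarrow> real" where
  "space_bound b \<epsilon> n k \<Delta> =
     (real k + log 2 (real n)) *
     (real k * 6 ^ k * log b \<Delta> + real k ^ k * (log b (1 / \<epsilon>)) ^ k)"

end

theory Submission
  imports Defs
begin

text \<open>The algorithm is greedy: a left vertex keeps the exact squared distances of one representative
  point to all centers, and a point of the stream joins the first vertex all of whose weights
  are accurate enough for it; if there is none, it becomes the representative of a new vertex.  So
  representatives are pairwise incompatible, and it remains to bound the size of a set \<open>R\<close> of pairwise
  incompatible points.

  Let \<open>g ^ 4 = 1 + \<epsilon>\<close> and classify \<open>p \<in> R - C\<close> by its nearest center \<open>a\<close> and the scale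
  \<open>t = \<rho> * g ^ i\<close> of its distance to \<open>a\<close>.  A center at distance at most \<open>(g - 1) * t\<close> from \<open>a\<close> is about as far
  from \<open>p\<close> as \<open>a\<close> is, and a center at distance at least \<open>4 * t / (g - 1)\<close> from \<open>a\<close> is about as far from
  \<open>p\<close> as from \<open>a\<close>.  Only the distances to the remaining, active, centers need to be rounded, and each of
  them has \<open>O(log\<^bsub>1 + \<epsilon>\<^esub> (1 / \<epsilon>))\<close> classes.  Every center is active for only \<open>O(log\<^bsub>1 + \<epsilon>\<^esub> (1 / \<epsilon>))\<close>
  scales, so all but \<open>k * O(log\<^bsub>1 + \<epsilon>\<^esub> (1 / \<epsilon>))\<close> scales contribute a single class per nearest center.\<close>

subsection \<open>Distances and their scales\<close>

lemma edist_nonneg [simp]: "0 \<le> edist p c"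
  by (simp add: edist_def L2_set_nonneg)

lemma edist_eq_0_iff:
  assumes "p \<in> euclid d" "c \<in> euclid d"
  shows "edist p c = 0 \<longleftrightarrow> p = c"
  using assms by (auto simp: edist_def euclid_def L2_set_eq_0_iff intro!: nth_equalityI)

lemma edist_commute:
  assumes "p \<in> euclid d" "q \<in> euclid d"
  shows "edist p q = edist q p"
  using assms by (simp add: edist_def euclid_def L2_set_def power2_commute)

lemma edist_triangle:
  assumes "p \<in> euclid d" "q \<in> euclid d" "r \<in> euclid d"
  shows "edist p r \<le> edist p q + edist q r"
  using L2_set_triangle_ineq[of "\<lambda>i. p ! i - q ! i" "\<lambda>i. q ! i - r ! i" "{..<d}"] assms
  by (simp add: edist_def euclid_def)

text \<open>Not symmetric: the squared distances of \<open>q\<close> play the role of the edge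
  weights, those of \<open>p\<close> the role of the true values.\<close>

definition close :: "real \<Rightarrow> point set \<Rightarrow> point \<Rightarrow> point \<Rightarrow> bool" where
  "close \<epsilon> C q p \<longleftrightarrow> (\<forall>c\<in>C. (1 - \<epsilon>) * (edist p c)\<^sup>2 \<le> (edist q c)\<^sup>2 \<and>
                          (edist q c)\<^sup>2 \<le> (1 + \<epsilon>) * (edist p c)\<^sup>2)"

lemma close_refl: "0 < \<epsilon> \<Longrightarrow> close \<epsilon> C p p"
  by (simp add: close_def mult_le_cancel_right1 mult_le_cancel_right2)

text \<open>A factor \<open>g\<^sup>2\<close> between distances is a factor
  \<open>1 + \<epsilon>\<close> between their squares. The lower bound follows as well because
  \<open>(1 - \<epsilon>) * (1 + \<epsilon>) \<le> 1\<close>.\<close>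

lemma close_if_ratio:
  assumes "0 < \<epsilon>" "\<epsilon> < 1" "g ^ 4 = 1 + \<epsilon>"
    and le: "\<And>c. c \<in> C \<Longrightarrow> edist p c \<le> g\<^sup>2 * edist q c \<and> edist q c \<le> g\<^sup>2 * edist p c"
  shows "close \<epsilon> C q p"
  unfolding close_def
proof (intro ballI conjI)
  fix c assume c: "c \<in> C"
  have sq: "(g\<^sup>2 * x)\<^sup>2 = (1 + \<epsilon>) * x\<^sup>2" for x
    by (simp add: power_mult_distrib assms flip: power_mult)
  have "(edist p c)\<^sup>2 \<le> (1 + \<epsilon>) * (edist q c)\<^sup>2"
    using power_mono[OF conjunct1[OF le[OF c]], of 2] by (simp add: sq)
  then have "(1 - \<epsilon>) * (edist p c)\<^sup>2 \<le> (1 - \<epsilon>) * ((1 + \<epsilon>) * (edist q c)\<^sup>2)"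
    using assms by (intro mult_left_mono) auto
  also have "\<dots> = (edist q c)\<^sup>2 - (\<epsilon> * edist q c)\<^sup>2"
    by (simp add: algebra_simps power2_eq_square)
  also have "\<dots> \<le> (edist q c)\<^sup>2" by simp
  finally show "(1 - \<epsilon>) * (edist p c)\<^sup>2 \<le> (edist q c)\<^sup>2" .
  show "(edist q c)\<^sup>2 \<le> (1 + \<epsilon>) * (edist p c)\<^sup>2"
    using power_mono[OF conjunct2[OF le[OF c]], of 2] by (simp add: sq)
qed

text \<open>The conversion to \<open>nat\<close> sends every positive argument below 1 to scale 0
  when \<open>1 < g\<close>, so the lemmas below are about arguments that are at least 1.\<close>

definition dist_scale :: "real \<Rightarrow> real \<Rightarrow> nat" where
  "dist_scale g x = nat \<lfloor>log g x\<rfloor>"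

lemma dist_scale_bounds:
  assumes "1 < g" "1 \<le> x"
  shows "g ^ dist_scale g x \<le> x" "x < g * g ^ dist_scale g x"
proof -
  have "0 \<le> log g x" using assms by simp
  then have r: "real (dist_scale g x) = of_int \<lfloor>log g x\<rfloor>"
    by (simp add: dist_scale_def)
  have "g powr real (dist_scale g x) \<le> x"
    using assms by (subst le_log_iff[symmetric]) (auto simp: r)
  then show "g ^ dist_scale g x \<le> x" using assms by (simp add: powr_realpow)
  have "log g x < real (dist_scale g x) + 1" unfolding r by linarith
  then have "x < g powr (real (dist_scale g x) + 1)"
    using assms by (subst log_less_iff[symmetric]) auto
  then show "x < g * g ^ dist_scale g x"
    using assms by (simp add: powr_add powr_realpow mult.commute)
qed

lemma dist_scale_le:
  assumes "1 < g" "1 \<le> x" "x \<le> y"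
  shows "dist_scale g x \<le> dist_scale g y"
  using assms by (auto simp: dist_scale_def intro!: nat_mono floor_mono)

lemma dist_scale_le_log:
  assumes "1 < g" "1 \<le> x"
  shows "real (dist_scale g x) \<le> log g x"
  using assms by (simp add: dist_scale_def)

lemma same_scale_ratio:
  assumes "1 < g" "1 \<le> x" "1 \<le> y" "dist_scale g x = dist_scale g y"
  shows "x \<le> g * y"
proof -
  have "x < g * g ^ dist_scale g y" using dist_scale_bounds(2)[of g x] assms by simp
  also have "\<dots> \<le> g * y" using dist_scale_bounds(1)[of g y] assms by simp
  finally show ?thesis by simp
qed

text \<open>A nonempty \<open>S\<close> lies in the interval from its minimum to its maximum;
  \<open>0 \<le> w\<close> settles the empty set.\<close>

lemma card_nat_le_width:
  fixes S :: "nat set"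
  assumes "finite S" "0 \<le> w" and w: "\<And>i j. i \<in> S \<Longrightarrow> j \<in> S \<Longrightarrow> i \<le> j \<Longrightarrow> real j - real i \<le> w"
  shows "real (card S) \<le> w + 1"
proof (cases "S = {}")
  case False
  have "card S \<le> card {Min S..Max S}"
    using assms False by (intro card_mono) auto
  also have "\<dots> = Max S + 1 - Min S" by simp
  finally have "card S + Min S \<le> Max S + 1"
    using assms(1) False Min_le[of S "Max S"] Max_in[of S] by linarith
  then have "real (card S) \<le> real (Max S) - real (Min S) + 1"
    by linarith
  moreover have "real (Max S) - real (Min S) \<le> w"
    using assms(1) False by (intro w) auto
  ultimately show ?thesis by linarith
qed (use assms in auto)

section \<open>Active centers and the number of cells\<close>

definition active :: "real \<Rightarrow> real \<Rightarrow> point set \<Rightarrow> point \<Rightarrow> nat \<Rightarrow> point set" where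
  "active g \<rho> C a i = {c \<in> C. (g - 1) * (\<rho> * g ^ i) < edist a c \<and>
                               (g - 1) * edist a c < 4 * (\<rho> * g ^ i)}"

lemma active_subset: "active g \<rho> C a i \<subseteq> C"
  by (auto simp: active_def)

text \<open>One quantity for two counts: the scales at which a given center is active, and the
  distance classes of an active center.\<close>

definition width :: "real \<Rightarrow> real" where
  "width g = 2 * log g (6 / (g - 1)) + 1"

lemma log_width_nonneg: "1 < g \<Longrightarrow> g \<le> 2 \<Longrightarrow> 0 \<le> log g (6 / (g - 1))"
  by (subst zero_le_log_cancel_iff) (simp_all add: pos_le_divide_eq)

lemma width_ge_1: "1 < g \<Longrightarrow> g \<le> 2 \<Longrightarrow> 1 \<le> width g"
  using log_width_nonneg by (simp add: width_def)

text \<open>A union bound over the centers. The scales at which one center is active have values of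
  \<open>g ^ i\<close> within a factor \<open>4 / (g - 1)\<^sup>2\<close> of each other.\<close>

lemma card_active_scales:
  assumes g: "1 < g" "g \<le> 2" and "0 < \<rho>" "finite C"
  shows "real (card {i \<in> {..I}. active g \<rho> C a i \<noteq> {}}) \<le> real (card C) * width g"
proof -
  define S where "S c = {i \<in> {..I}. c \<in> active g \<rho> C a i}" for c
  have S: "real (card (S c)) \<le> width g" for c
  proof -
    have "real (card (S c)) \<le> 2 * log g (6 / (g - 1)) + 1"
    proof (rule card_nat_le_width)
      show "finite (S c)" by (simp add: S_def)
      show "0 \<le> 2 * log g (6 / (g - 1))" using log_width_nonneg[OF g] by simp
      fix i j assume ij: "i \<in> S c" "j \<in> S c" "i \<le> j"
      \<comment> \<open>The lower threshold at the larger scale \<open>j\<close> is combined with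
        the upper threshold at the smaller scale \<open>i\<close>.\<close>
      have "(g - 1) * ((g - 1) * (\<rho> * g ^ j)) < (g - 1) * edist a c"
        using ij g by (intro mult_strict_left_mono) (auto simp: S_def active_def)
      also have "\<dots> < 4 * (\<rho> * g ^ i)"
        using ij by (auto simp: S_def active_def)
      also have "g ^ j = g ^ (j - i) * g ^ i"
        using ij by (simp flip: power_add)
      finally have "((g - 1) * (g - 1) * g ^ (j - i)) * (\<rho> * g ^ i) < 4 * (\<rho> * g ^ i)"
        by (simp only: mult_ac)
      then have "(g - 1) * (g - 1) * g ^ (j - i) < 4"
        using g \<open>0 < \<rho>\<close> by (subst (asm) mult_less_cancel_right_pos) auto
      then have "g ^ (j - i) \<le> 4 / (g - 1)\<^sup>2"
        using g by (simp add: pos_le_divide_eq power2_eq_square mult_ac)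
      \<comment> \<open>Raising 4 to 36 makes this the logarithm that also counts the distance
        classes.\<close>
      also have "\<dots> \<le> (6 / (g - 1))\<^sup>2"
        using g by (simp add: power_divide divide_right_mono)
      finally have "log g (g ^ (j - i)) \<le> log g ((6 / (g - 1))\<^sup>2)"
        using g by (subst log_le_cancel_iff) auto
      then show "real j - real i \<le> 2 * log g (6 / (g - 1))"
        using ij g by (simp add: log_nat_power of_nat_diff)
    qed
    then show ?thesis by (simp add: width_def)
  qed
  have "{i \<in> {..I}. active g \<rho> C a i \<noteq> {}} = (\<Union>c\<in>C. S c)"
    by (auto simp: S_def active_def)
  then have "card {i \<in> {..I}. active g \<rho> C a i \<noteq> {}} \<le> (\<Sum>c\<in>C. card (S c))"
    using card_UN_le[OF \<open>finite C\<close>] by simp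
  then have "real (card {i \<in> {..I}. active g \<rho> C a i \<noteq> {}}) \<le> (\<Sum>c\<in>C. real (card (S c)))"
    unfolding of_nat_sum[symmetric] of_nat_le_iff .
  also have "\<dots> \<le> (\<Sum>c\<in>C. width g)" by (intro sum_mono S)
  finally show ?thesis by simp
qed

text \<open>The distance from a point to an active center, divided by the scale of the point, lies
  between 1 and \<open>6 / (g - 1)\<close> by \<open>active_bound\<close>; this is the number of
  scales in that range.\<close>

definition classes :: "real \<Rightarrow> nat" where
  "classes g = dist_scale g (6 / (g - 1)) + 1"

lemma classes_le_width:
  assumes "1 < g" "g \<le> 2" shows "real (classes g) \<le> width g"
proof -
  have "1 \<le> 6 / (g - 1)" using assms by (simp add: pos_le_divide_eq)
  then show ?thesis
    using dist_scale_le_log[of g "6 / (g - 1)"] log_width_nonneg[of g] assms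
    by (simp add: classes_def width_def)
qed

text \<open>The possible values of \<open>cell\<close>. Functions are fixed outside the active
  centers, so that equality of cells is agreement on active centers and the cardinality is a power
  of \<open>classes g\<close>.\<close>

definition cells :: "real \<Rightarrow> real \<Rightarrow> nat \<Rightarrow> point set \<Rightarrow> (point \<times> nat \<times> (point \<Rightarrow> nat)) set" where
  "cells g \<rho> I C = (SIGMA a:C. SIGMA i:{..I}. active g \<rho> C a i \<rightarrow>\<^sub>E {..<classes g})"

lemma finite_active: "finite C \<Longrightarrow> finite (active g \<rho> C a i)"
  by (rule finite_subset[OF active_subset])

lemma finite_cells: "finite C \<Longrightarrow> finite (cells g \<rho> I C)"
  by (auto simp: cells_def intro!: finite_SigmaI finite_PiE finite_active)

text \<open>For each nearest center, every scale pays 1, which covers the scales without active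
  centers. Only \<open>k * width g\<close> scales have active centers, and each of them pays at most
  \<open>width g ^ (k - 1)\<close> more, where \<open>k\<close> is the number of centers.\<close>

lemma card_cells:
  assumes g: "1 < g" "g \<le> 2" and "0 < \<rho>" "finite C" and CE: "C \<subseteq> euclid d"
  shows "real (card (cells g \<rho> I C)) \<le>
    real (card C) * (real I + 1) + (real (card C))\<^sup>2 * width g ^ card C"
proof -
  let ?w = "width g" and ?k = "card C"
  have row: "(\<Sum>i\<le>I. real (classes g) ^ card (active g \<rho> C a i))
      \<le> (real I + 1) + real ?k * ?w ^ ?k" if a: "a \<in> C" for a
  proof -
    have one: "real (classes g) ^ card (active g \<rho> C a i)
        \<le> 1 + (if active g \<rho> C a i \<noteq> {} then ?w ^ (?k - 1) else 0)" for i
    proof (cases "active g \<rho> C a i = {}")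
      case False
      \<comment> \<open>The nearest center itself is never active. This lowers the exponent to
        \<open>k - 1\<close> and leaves room for the factor \<open>width g\<close> from the number
        of scales.\<close>
      have "edist a a = 0" using edist_eq_0_iff a CE by blast
      then have "a \<notin> active g \<rho> C a i"
        using g \<open>0 < \<rho>\<close> by (simp add: active_def not_less)
      then have "active g \<rho> C a i \<subseteq> C - {a}" using active_subset by blast
      then have "card (active g \<rho> C a i) \<le> ?k - 1"
        using card_mono[of "C - {a}" "active g \<rho> C a i"] \<open>finite C\<close> a by simp
      moreover have "real (classes g) ^ card (active g \<rho> C a i) \<le> ?w ^ card (active g \<rho> C a i)"
        using classes_le_width[OF g] by (intro power_mono) auto
      ultimately show ?thesis
        using power_increasing[of "card (active g \<rho> C a i)" "?k - 1" ?w] width_ge_1[OF g] False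
        by simp
    qed auto
    have "(\<Sum>i\<le>I. real (classes g) ^ card (active g \<rho> C a i))
       \<le> (\<Sum>i\<le>I. 1 + (if active g \<rho> C a i \<noteq> {} then ?w ^ (?k - 1) else 0))"
      by (intro sum_mono one)
    also have "\<dots> = (real I + 1) + real (card {i \<in> {..I}. active g \<rho> C a i \<noteq> {}}) * ?w ^ (?k - 1)"
      by (simp add: sum.distrib flip: sum.inter_filter)
    also have "\<dots> \<le> (real I + 1) + (real ?k * ?w) * ?w ^ (?k - 1)"
      using card_active_scales[OF g \<open>0 < \<rho>\<close> \<open>finite C\<close>] width_ge_1[OF g]
      by (intro add_left_mono mult_right_mono) auto
    also have "(real ?k * ?w) * ?w ^ (?k - 1) = real ?k * (?w * ?w ^ (?k - 1))" by simp
    \<comment> \<open>The subtraction is truncated; \<open>a \<in> C\<close> ensures that there is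
      at least one center.\<close>
    also have "?w * ?w ^ (?k - 1) = ?w ^ ?k"
      using power_minus_mult[of ?k ?w] a \<open>finite C\<close> by (auto simp: card_gt_0_iff mult.commute)
    finally show ?thesis .
  qed
  have "real (card (cells g \<rho> I C)) =
      (\<Sum>a\<in>C. \<Sum>i\<le>I. real (classes g) ^ card (active g \<rho> C a i))"
    using \<open>finite C\<close>
    by (simp add: cells_def finite_PiE finite_active card_PiE finite_SigmaI)
  also have "\<dots> \<le> (\<Sum>a\<in>C. (real I + 1) + real ?k * ?w ^ ?k)"
    by (intro sum_mono row)
  also have "\<dots> = real ?k * (real I + 1) + (real ?k)\<^sup>2 * ?w ^ ?k"
    by (simp add: algebra_simps power2_eq_square)
  finally show ?thesis .
qed

subsection \<open>Incompatible points\<close>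

definition nearest :: "point set \<Rightarrow> point \<Rightarrow> point" where
  "nearest C p = arg_min_on (edist p) C"

lemma nearest:
  assumes "finite C" "C \<noteq> {}"
  shows "nearest C p \<in> C" "c \<in> C \<Longrightarrow> edist p (nearest C p) \<le> edist p c"
  unfolding nearest_def
  using arg_min_if_finite(1)[OF assms, of "edist p"] arg_min_least[OF assms, of c "edist p"]
  by simp_all

definition radius_scale :: "real \<Rightarrow> real \<Rightarrow> point set \<Rightarrow> point \<Rightarrow> nat" where
  "radius_scale g \<rho> C p = dist_scale g (edist p (nearest C p) / \<rho>)"

definition cell :: "real \<Rightarrow> real \<Rightarrow> point set \<Rightarrow> point \<Rightarrow> point \<times> nat \<times> (point \<Rightarrow> nat)" where
  "cell g \<rho> C p =
     (let a = nearest C p; i = radius_scale g \<rho> C p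
      in (a, i, \<lambda>c\<in>active g \<rho> C a i. dist_scale g (edist p c / (\<rho> * g ^ i))))"

lemma radius_scale_bounds:
  assumes "1 < g" "0 < \<rho>" "\<rho> \<le> edist p (nearest C p)"
  shows "\<rho> * g ^ radius_scale g \<rho> C p \<le> edist p (nearest C p)"
    "edist p (nearest C p) < g * (\<rho> * g ^ radius_scale g \<rho> C p)"
  using dist_scale_bounds[of g "edist p (nearest C p) / \<rho>"] assms
  by (simp_all add: radius_scale_def field_simps)

text \<open>The upper bound is the triangle inequality through the nearest center, the lower bound
  holds since no center is nearer than that one. Hence rounding by \<open>dist_scale\<close> is
  faithful and has at most \<open>classes g\<close> outcomes.\<close>

lemma active_bound:
  assumes g: "1 < g" "g \<le> 2" and "0 < \<rho>" "\<rho> \<le> edist p (nearest C p)"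
    and "p \<in> euclid d" "C \<subseteq> euclid d" "finite C" "C \<noteq> {}"
    and c: "c \<in> active g \<rho> C (nearest C p) (radius_scale g \<rho> C p)"
  shows "edist p c / (\<rho> * g ^ radius_scale g \<rho> C p) \<le> 6 / (g - 1)"
    "1 \<le> edist p c / (\<rho> * g ^ radius_scale g \<rho> C p)"
proof -
  define a where "a = nearest C p"
  define t where "t = \<rho> * g ^ radius_scale g \<rho> C p"
  have t: "0 < t" using g \<open>0 < \<rho>\<close> by (simp add: t_def)
  have r: "t \<le> edist p a" "edist p a < g * t"
    using radius_scale_bounds[of g \<rho> p C] assms by (simp_all add: t_def a_def)
  have "c \<in> C" using c active_subset by blast
  have D: "(g - 1) * edist a c < 4 * t" using c by (simp add: active_def t_def a_def)
  have "a \<in> C" using nearest assms by (simp add: a_def)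
  then have "edist p c \<le> edist p a + edist a c"
    using edist_triangle \<open>c \<in> C\<close> assms by blast
  then have "(g - 1) * edist p c \<le> (g - 1) * (g * t + edist a c)"
    using r g by (intro mult_left_mono) auto
  also have "\<dots> \<le> g * (g - 1) * t + 4 * t" using D by (simp add: algebra_simps)
  \<comment> \<open>By \<open>g \<le> 2\<close>; this sum is the origin of the constant 6.\<close>
  also have "\<dots> \<le> 2 * 1 * t + 4 * t"
    using g t by (intro add_right_mono mult_right_mono mult_mono) auto
  finally show "edist p c / (\<rho> * g ^ radius_scale g \<rho> C p) \<le> 6 / (g - 1)"
    using g t by (simp add: field_simps flip: t_def)
  have "t \<le> edist p c"
    using r nearest(2)[of C c p] \<open>c \<in> C\<close> assms by (simp add: a_def)
  then show "1 \<le> edist p c / (\<rho> * g ^ radius_scale g \<rho> C p)"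
    using t by (simp flip: t_def)
qed

text \<open>Later \<rho> is the smallest distance from \<open>X - C\<close> and \<open>m\<close> the
  largest from \<open>X\<close>, so that the range of scales is governed by
  \<open>Delta\<close>.\<close>

lemma cell_in_cells:
  assumes g: "1 < g" "g \<le> 2" and \<rho>: "0 < \<rho>" "\<rho> \<le> edist p (nearest C p)"
    and C: "p \<in> euclid d" "C \<subseteq> euclid d" "finite C" "C \<noteq> {}"
    and m: "edist p (nearest C p) \<le> m"
  shows "cell g \<rho> C p \<in> cells g \<rho> (dist_scale g (m / \<rho>)) C"
proof -
  have "radius_scale g \<rho> C p \<le> dist_scale g (m / \<rho>)"
    unfolding radius_scale_def using \<rho> m g by (intro dist_scale_le) (auto simp: divide_right_mono)
  moreover have "dist_scale g (edist p c / (\<rho> * g ^ radius_scale g \<rho> C p)) < classes g"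
    if "c \<in> active g \<rho> C (nearest C p) (radius_scale g \<rho> C p)" for c
    using dist_scale_le[OF g(1) active_bound(2,1)[OF g \<rho> C that]] by (simp add: classes_def)
  ultimately show ?thesis
    using nearest(1)[of C p] C by (auto simp: cell_def cells_def Let_def)
qed

text \<open>One inequality suffices, since the hypotheses are symmetric in \<open>p\<close> and
  \<open>q\<close>. Inactive centers are handled by the triangle inequality through the common
  nearest center, active ones by their equal rounded distances.\<close>

lemma same_cell_ratio:
  assumes g: "1 < g" "g \<le> 2" and "0 < \<rho>"
    and \<rho>: "\<rho> \<le> edist p (nearest C p)" "\<rho> \<le> edist q (nearest C q)"
    and E: "p \<in> euclid d" "q \<in> euclid d" "C \<subseteq> euclid d" and C: "finite C" "C \<noteq> {}"
    and same: "cell g \<rho> C p = cell g \<rho> C q" and c: "c \<in> C"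
  shows "edist p c \<le> g\<^sup>2 * edist q c"
proof -
  define a i where "a = nearest C p" and "i = radius_scale g \<rho> C p"
  have eq: "a = nearest C q" "i = radius_scale g \<rho> C q"
    and act: "\<And>c. c \<in> active g \<rho> C a i \<Longrightarrow>
        dist_scale g (edist p c / (\<rho> * g ^ i)) = dist_scale g (edist q c / (\<rho> * g ^ i))"
    using same by (auto simp: cell_def Let_def a_def i_def dest!: fun_cong split: if_splits)
  define t where "t = \<rho> * g ^ i"
  have t: "0 < t" using g \<open>0 < \<rho>\<close> by (simp add: t_def)
  have rp: "edist p a < g * t"
    using radius_scale_bounds[of g \<rho> p C] g \<rho> \<open>0 < \<rho>\<close> by (simp_all add: t_def a_def i_def)
  have rq: "t \<le> edist q a" "edist q a < g * t"
    using radius_scale_bounds[of g \<rho> q C] g \<rho> \<open>0 < \<rho>\<close> by (simp_all add: t_def eq)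
  have "a \<in> C" using nearest C by (simp add: a_def)
  then have aE: "a \<in> euclid d" "c \<in> euclid d" using c E by auto
  have pc: "edist p c \<le> edist p a + edist a c"
    and qc: "edist a c \<le> edist q a + edist q c"
    using edist_triangle[of p d a c] edist_triangle[of a d q c] edist_commute[of a d q] aE E by auto
  have tq: "t \<le> edist q c"
    using rq nearest(2)[OF C c, of q] by (simp flip: eq)
  consider "edist a c \<le> (g - 1) * t" | "4 * t \<le> (g - 1) * edist a c" | "c \<in> active g \<rho> C a i"
    using c by (fastforce simp: active_def t_def)
  then show ?thesis
  proof cases
    case 1
    \<comment> \<open>The square expands to \<open>2 * g - 1 \<le> g\<^sup>2\<close>, which is the
      inequality required for a center near \<open>a\<close>.\<close>
    have "0 \<le> (g - 1)\<^sup>2 * t" using t by simp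
    then have "g * t + (g - 1) * t \<le> g\<^sup>2 * t"
      by (simp add: algebra_simps power2_eq_square)
    also have "\<dots> \<le> g\<^sup>2 * edist q c" using tq by (intro mult_left_mono) auto
    finally show ?thesis using pc rp 1 by linarith
  next
    case 2
    \<comment> \<open>With D the distance from \<open>a\<close> to \<open>c\<close>, the target is D
      + g t \<le> g^2 (D - g t), that is, (g + g^3) t \<le> (g + 1) (g - 1) D. The threshold 4 t
      \<le> (g - 1) D suffices because g + g^3 \<le> 4 (g + 1).\<close>
    have "g * g \<le> 2 * 2" using g by (intro mult_mono) auto
    then have "g ^ 3 \<le> 4 * g" using g by (simp add: power3_eq_cube)
    then have "g + g ^ 3 \<le> g + 4 * g" by (rule add_left_mono)
    also have "\<dots> \<le> 4 * (g + 1)" using g by simp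
    finally have "(g + g ^ 3) * t \<le> (4 * (g + 1)) * t"
      using t by (intro mult_right_mono) auto
    also have "\<dots> \<le> (g + 1) * ((g - 1) * edist a c)"
      using mult_left_mono[OF 2, of "g + 1"] g by (simp add: mult_ac)
    finally have "edist a c + g * t \<le> g\<^sup>2 * (edist a c - g * t)"
      by (simp add: algebra_simps power2_eq_square power3_eq_cube)
    also have "\<dots> \<le> g\<^sup>2 * edist q c"
      using qc rq by (intro mult_left_mono) auto
    finally show ?thesis using pc rp by linarith
  next
    case 3
    have "1 \<le> edist p c / t"
      using active_bound(2)[OF g \<open>0 < \<rho>\<close> \<rho>(1) E(1,3) C, of c] 3 by (simp add: t_def a_def i_def)
    moreover have "1 \<le> edist q c / t"
      using active_bound(2)[OF g \<open>0 < \<rho>\<close> \<rho>(2) E(2,3) C, of c] 3 by (simp add: t_def eq)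
    ultimately have "edist p c / t \<le> g * (edist q c / t)"
      using act[OF 3] g(1) by (intro same_scale_ratio) (simp_all add: t_def)
    then have "edist p c \<le> g * edist q c" using t by (simp add: field_simps)
    also have "\<dots> \<le> g\<^sup>2 * edist q c"
      using g by (intro mult_right_mono) (auto simp: power2_eq_square)
    finally show ?thesis .
  qed
qed

text \<open>Two points outside \<open>C\<close> with the same cell are close to each other in both
  directions, so \<open>cell\<close> is injective on \<open>R - C\<close> and
  \<open>card_cells\<close> applies. The number of scales is logarithmic in the ratio of the largest
  to the smallest distance, which is \<open>Delta\<close>.\<close>

lemma card_separated_le:
  assumes pc: "points_and_centers d n k X C" and \<epsilon>: "0 < \<epsilon>" "\<epsilon> < 1"
    and g: "1 < g" "g ^ 4 = 1 + \<epsilon>"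
    and R: "R \<subseteq> X" "\<And>p q. p \<in> R \<Longrightarrow> q \<in> R \<Longrightarrow> p \<noteq> q \<Longrightarrow> \<not> (close \<epsilon> C p q \<and> close \<epsilon> C q p)"
  shows "real (card R) \<le> real k + real k * (log g (Delta X C) + 1) + (real k)\<^sup>2 * width g ^ k"
    and "1 \<le> Delta X C"
proof -
  have X: "X \<subseteq> euclid d" "finite X" and C: "C \<subseteq> euclid d" "finite C" "C \<noteq> {}"
    and k: "card C = k" and ne: "X - C \<noteq> {}"
    using pc by (auto simp: points_and_centers_def)
  define Ds where "Ds Y = {edist p c | p c. p \<in> Y \<and> c \<in> C}" for Y
  define m where "m = Max (Ds X)"
  define \<rho> where "\<rho> = Min (Ds (X - C))"
  have Ds: "Ds Y = (\<lambda>(p, c). edist p c) ` (Y \<times> C)" for Y by (auto simp: Ds_def)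
  have fin: "finite (Ds X)" "finite (Ds (X - C))" using X C by (auto simp: Ds)
  have ne': "Ds (X - C) \<noteq> {}" using ne C(3) by (auto simp: Ds)
  have D: "Delta X C = m / \<rho>" by (simp add: Delta_def m_def \<rho>_def Ds_def)
  have m: "edist p c \<le> m" if "p \<in> X" "c \<in> C" for p c
    using that fin by (auto simp: m_def Ds_def intro!: Max_ge)
  have \<rho>: "\<rho> \<le> edist p c" if "p \<in> X - C" "c \<in> C" for p c
    using that fin by (auto simp: \<rho>_def Ds_def intro!: Min_le)
  have "\<rho> \<in> Ds (X - C)" unfolding \<rho>_def using fin ne' by (intro Min_in)
  then obtain p\<^sub>0 c\<^sub>0 where p0: "\<rho> = edist p\<^sub>0 c\<^sub>0" "p\<^sub>0 \<in> X - C" "c\<^sub>0 \<in> C"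
    by (auto simp: Ds_def)
  then have "\<rho> \<noteq> 0" using edist_eq_0_iff[of p\<^sub>0 d c\<^sub>0] X C by auto
  then have pos: "0 < \<rho>" using p0 by (simp add: less_le)
  show D1: "1 \<le> Delta X C" using m[of p\<^sub>0 c\<^sub>0] p0 pos by (simp add: D)
  have g2: "g \<le> 2"
  proof (rule ccontr)
    assume "\<not> g \<le> 2"
    then have "2 ^ 4 \<le> g ^ 4" by (intro power_mono) auto
    then show False using g \<epsilon> by simp
  qed
  define I where "I = dist_scale g (m / \<rho>)"
  have inj: "inj_on (cell g \<rho> C) (R - C)"
  proof (rule inj_onI, rule ccontr)
    fix p q assume pq: "p \<in> R - C" "q \<in> R - C" and eq: "cell g \<rho> C p = cell g \<rho> C q" "p \<noteq> q"
    have far: "\<rho> \<le> edist r (nearest C r)" if "r \<in> R - C" for r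
      using that R(1) \<rho> nearest(1)[OF C(2,3)] by blast
    have E: "p \<in> euclid d" "q \<in> euclid d" using pq R(1) X by auto
    have "edist p c \<le> g\<^sup>2 * edist q c \<and> edist q c \<le> g\<^sup>2 * edist p c" if "c \<in> C" for c
      using same_cell_ratio[OF g(1) g2 pos far far E C eq(1) that]
        same_cell_ratio[OF g(1) g2 pos far far E(2,1) C eq(1)[symmetric] that] pq by blast
    then have "close \<epsilon> C p q \<and> close \<epsilon> C q p"
      using close_if_ratio[OF \<epsilon> g(2)] by blast
    then show False using R(2)[of p q] pq eq by blast
  qed
  have "cell g \<rho> C ` (R - C) \<subseteq> cells g \<rho> I C"
    unfolding I_def
  proof (intro image_subsetI cell_in_cells[OF g(1) g2 pos _ _ C])
    fix p assume "p \<in> R - C"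
    then have p: "p \<in> X - C" using R by auto
    then show "\<rho> \<le> edist p (nearest C p)" "p \<in> euclid d" "edist p (nearest C p) \<le> m"
      using \<rho> m nearest(1)[OF C(2,3)] X by auto
  qed
  then have "card (R - C) \<le> card (cells g \<rho> I C)"
    using card_inj_on_le[OF inj] finite_cells[OF C(2)] by blast
  \<comment> \<open>Points that are centers themselves have distance 0 to a center and hence no
    scale; they are counted individually.\<close>
  moreover have "card (R \<inter> C) \<le> k" using C k by (auto intro: card_mono)
  moreover have "card R = card (R - C) + card (R \<inter> C)"
    using R X by (subst card_Un_disjoint[symmetric]) (auto intro: finite_subset arg_cong[of _ _ card])
  ultimately have "real (card R) \<le> real k + real (card (cells g \<rho> I C))" by linarith
  also have "\<dots> \<le> real k + (real k * (real I + 1) + (real k)\<^sup>2 * width g ^ k)"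
    using card_cells[OF g(1) g2 pos C(2,1), of I] by (simp add: k)
  also have "\<dots> \<le> real k + (real k * (log g (Delta X C) + 1) + (real k)\<^sup>2 * width g ^ k)"
    using dist_scale_le_log[OF g(1) D1]
    by (intro add_mono mult_left_mono) (auto simp: I_def D)
  finally show "real (card R) \<le> real k + real k * (log g (Delta X C) + 1) + (real k)\<^sup>2 * width g ^ k"
    by simp
qed

subsection \<open>The greedy algorithm\<close>

text \<open>Cells 0 to 2 are the output header, with the constants 5 and 0 as addresses; cells 3 and
  4 are loop indices; the counters start at cell 5. The array of reals holds nothing but the weight
  matrix, one row per vertex.\<close>

abbreviation "num_vertices \<equiv> NLoad (NConst 0)"
abbreviation "vertex \<equiv> NLoad (NConst 3)"
abbreviation "center \<equiv> NLoad (NConst 4)"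
abbreviation "counter \<equiv> NAdd (NConst 5) vertex"
abbreviation "weight_address \<equiv> NAdd (NMul vertex NumCenters) center"

text \<open>Programs have only strict comparisons, so the two weak inequalities of
  \<open>close\<close> appear as negations.\<close>

definition agrees :: bexp where
  "agrees = And
     (Not (RLess (RLoad weight_address) (RMul (RSub (ROfNat (NConst 1)) Eps) (SqDist center))))
     (Not (RLess (RMul (RAdd (ROfNat (NConst 1)) Eps) (SqDist center)) (RLoad weight_address)))"

text \<open>One loop runs through the pairs of vertex and center: agreement advances the center,
  disagreement moves on to center 0 of the next vertex. It stops before the last vertex is exceeded
  only if some vertex agrees at all centers.\<close>

definition search :: com where
  "search = While (And (NLess vertex num_vertices) (NLess center NumCenters))
     (If agrees (NStore (NConst 4) (NAdd center (NConst 1)))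
       (Seq (NStore (NConst 3) (NAdd vertex (NConst 1))) (NStore (NConst 4) (NConst 0))))"

definition write_row :: com where
  "write_row = While (NLess center NumCenters)
     (Seq (RStore weight_address (SqDist center)) (NStore (NConst 4) (NAdd center (NConst 1))))"

text \<open>The increment also serves a new vertex: reading beyond the end of the array yields 0, and storing
  there allocates the counter.\<close>

definition insert_point :: com where
  "insert_point = Seq (NStore (NConst 3) (NConst 0)) (Seq (NStore (NConst 4) (NConst 0)) (Seq search
     (Seq (NStore counter (NAdd (NLoad counter) (NConst 1)))
       (If (NLess vertex num_vertices) Skip
         (Seq write_row (NStore (NConst 0) (NAdd num_vertices (NConst 1))))))))"

text \<open>Storing to cell 4 also allocates cells 2 and 3 with value 0; cell 2 is the address of
  the weight matrix.\<close>

definition greedy :: streaming_algorithm where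
  "greedy = \<lparr>initialize = Seq (NStore (NConst 1) (NConst 5)) (NStore (NConst 4) (NConst 0)),
     update = insert_point, finalize = Skip\<rparr>"

section \<open>Memory layout and space accounting\<close>

lemma store_header [simp]:
  "store (m # a # b # v # j # cnts) 0 x = x # a # b # v # j # cnts"
  "store (m # a # b # v # j # cnts) 3 x = m # a # b # x # j # cnts"
  "store (m # a # b # v # j # cnts) 4 x = m # a # b # v # x # cnts"
  by (simp_all add: store_def numeral_eq_Suc)

lemma fetch_header [simp]:
  "fetch (m # a # b # v # j # cnts) 0 = m"
  "fetch (m # a # b # v # j # cnts) 3 = v"
  "fetch (m # a # b # v # j # cnts) 4 = j"
  "fetch (m # a # b # v # j # cnts) (5 + u) = fetch cnts u"
  by (simp_all add: fetch_def numeral_eq_Suc)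

lemma store_counter [simp]:
  "u \<le> length cnts \<Longrightarrow> store (m # a # b # v # j # cnts) (5 + u) x = m # a # b # v # j # store cnts u x"
  by (simp add: store_def numeral_eq_Suc)

lemma store_end: "store xs (length xs) x = xs @ [x]"
  by (simp add: store_def)

text \<open>The header consists of two numbers up to \<open>n\<close>, the constants 5 and 0 with
  fewer than 5 bits together, and an index up to \<open>k\<close>, charged at most \<open>k\<close>
  bits. Then come at most \<open>M\<close> counters and \<open>M\<close> rows of weights.\<close>

definition space_cap :: "nat \<Rightarrow> nat \<Rightarrow> nat \<Rightarrow> nat" where
  "space_cap n M k = 2 * bits n + 5 + k + M * bits n + M * k"

text \<open>The lengths of the arrays are not tied to \<open>m\<close>: while a vertex is being
  added, its counter and its row exist before the number of vertices is raised.\<close>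

definition fits :: "nat \<Rightarrow> nat \<Rightarrow> nat \<Rightarrow> nat \<Rightarrow> nat \<Rightarrow> nat \<Rightarrow> nat list \<Rightarrow> real list \<Rightarrow> bool" where
  "fits n M k m v j cnts ws \<longleftrightarrow> m \<le> n \<and> v \<le> n \<and> j \<le> k \<and>
     length cnts \<le> M \<and> (\<forall>x\<in>set cnts. x \<le> n) \<and> length ws \<le> M * k"

definition config ::
    "nat \<Rightarrow> nat \<Rightarrow> nat \<Rightarrow> nat \<Rightarrow> nat \<Rightarrow> nat \<Rightarrow> nat list \<Rightarrow> real list \<Rightarrow> state \<Rightarrow> bool" where
  "config n M k m v j cnts ws \<sigma> \<longleftrightarrow> nats \<sigma> = m # 5 # 0 # v # j # cnts \<and> reals \<sigma> = ws \<and>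
     fits n M k m v j cnts ws \<and> peak \<sigma> \<le> space_cap n M k"

lemma bits_mono: "m \<le> n \<Longrightarrow> bits m \<le> bits n"
  unfolding bits_def using floorlog_mono[of m n 2] by linarith

lemma bits_le: "bits k \<le> max 1 k"
proof -
  have "k < 2 ^ k" by (rule less_exp)
  then have "floorlog 2 k \<le> k" by (intro floorlog_leI) auto
  then show ?thesis by (simp add: bits_def)
qed

lemma bits_le_log:
  assumes "1 \<le> n" shows "real (bits n) \<le> 1 + log 2 (real n)"
proof -
  have "real (floorlog 2 n) = real_of_int \<lfloor>log 2 (real n)\<rfloor> + 1"
    using assms by (simp add: floorlog_def of_nat_nat zero_le_log_cancel_iff)
  then show ?thesis using assms by (simp add: bits_def max_def)
qed

lemma bits_small: "bits 0 = 1" "bits 5 = 3"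
  by (simp_all add: bits_def compute_floorlog)

text \<open>\<open>touch\<close> raises \<open>peak\<close> at most to the current space, and
  \<open>fits\<close> bounds that by \<open>space_cap\<close>. So a store only has to preserve
  \<open>fits\<close>.\<close>

lemma config_touch:
  assumes "1 \<le> k" "fits n M k m v j cnts ws" "peak \<sigma> \<le> space_cap n M k"
    and \<sigma>: "nats \<sigma> = m # 5 # 0 # v # j # cnts" "reals \<sigma> = ws"
  shows "config n M k m v j cnts ws (touch \<sigma>)"
proof -
  have "bits m \<le> bits n" "bits v \<le> bits n" "bits j \<le> k"
    using assms bits_le[of j] by (auto simp: fits_def bits_mono)
  moreover have "sum_list (map bits cnts) \<le> M * bits n"
  proof -
    have "sum_list (map bits cnts) \<le> sum_list (map (\<lambda>_. bits n) cnts)"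
      using assms by (intro sum_list_mono bits_mono) (auto simp: fits_def)
    also have "\<dots> \<le> M * bits n" using assms by (simp add: sum_list_triv fits_def)
    finally show ?thesis .
  qed
  moreover have "length ws \<le> M * k" using assms by (simp add: fits_def)
  ultimately have "space \<sigma> \<le> space_cap n M k"
    by (simp add: space_def space_cap_def \<sigma> bits_small)
  then show ?thesis using assms by (simp add: config_def touch_def)
qed

section \<open>Weight rows and the invariant of the greedy algorithm\<close>

definition weight_row :: "point list \<Rightarrow> point \<Rightarrow> real list" where
  "weight_row cs r = map (\<lambda>c. (edist r c)\<^sup>2) cs"

lemma length_rows: "length (concat (map (weight_row cs) rs)) = length rs * length cs"
  by (induction rs) (auto simp: weight_row_def)

lemma nth_rows:
  "u < length rs \<Longrightarrow> i < length cs \<Longrightarrow>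
     concat (map (weight_row cs) rs) ! (u * length cs + i) = (edist (rs ! u) (cs ! i))\<^sup>2"
proof (induction rs arbitrary: u)
  case (Cons r rs)
  then show ?case by (cases u) (auto simp: weight_row_def nth_append)
qed simp

text \<open>\<open>Y\<close> is the part of the stream already processed. Representatives are listed
  by age, and only closeness of an older one to a younger one is excluded, since this is the
  direction tested on arrival. The assignment of points to vertices is not stored and hence
  existential.\<close>

definition invariant :: "real \<Rightarrow> point set \<Rightarrow> point set \<Rightarrow> point list \<Rightarrow> nat list \<Rightarrow> bool" where
  "invariant \<epsilon> C Y reps cnts \<longleftrightarrow>
     length cnts = length reps \<and> set reps \<subseteq> Y \<and> distinct reps \<and>
     (\<forall>v<length reps. \<forall>u<v. \<not> close \<epsilon> C (reps ! u) (reps ! v)) \<and>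
     (\<exists>\<phi>. (\<forall>p\<in>Y. \<phi> p < length reps \<and> close \<epsilon> C (reps ! \<phi> p) p) \<and>
          (\<forall>v<length reps. cnts ! v = card {p \<in> Y. \<phi> p = v}))"

lemma invariant_join:
  assumes inv: "invariant \<epsilon> C Y reps cnts" and "finite Y" "p \<notin> Y"
    and v: "v < length reps" "close \<epsilon> C (reps ! v) p"
  shows "invariant \<epsilon> C (insert p Y) reps (cnts[v := cnts ! v + 1])"
proof -
  from inv obtain \<phi> where \<phi>: "\<forall>p\<in>Y. \<phi> p < length reps \<and> close \<epsilon> C (reps ! \<phi> p) p"
      "\<forall>v<length reps. cnts ! v = card {p \<in> Y. \<phi> p = v}"
    by (auto simp: invariant_def)
  have "{q \<in> insert p Y. (\<phi>(p := v)) q = u} =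
      (if u = v then insert p {q \<in> Y. \<phi> q = u} else {q \<in> Y. \<phi> q = u})" for u
    using \<open>p \<notin> Y\<close> by auto
  then have "\<forall>u<length reps. cnts[v := cnts ! v + 1] ! u = card {q \<in> insert p Y. (\<phi>(p := v)) q = u}"
    using inv \<phi>(2) \<open>finite Y\<close> \<open>p \<notin> Y\<close> v by (auto simp: nth_list_update invariant_def)
  moreover have "\<forall>q\<in>insert p Y. (\<phi>(p := v)) q < length reps \<and> close \<epsilon> C (reps ! (\<phi>(p := v)) q) q"
    using \<phi>(1) v by auto
  ultimately show ?thesis
    using inv unfolding invariant_def by (intro conjI exI[of _ "\<phi>(p := v)"]) auto
qed

lemma invariant_new:
  assumes inv: "invariant \<epsilon> C Y reps cnts" and "p \<notin> Y" "0 < \<epsilon>"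
    and new: "\<forall>u<length reps. \<not> close \<epsilon> C (reps ! u) p"
  shows "invariant \<epsilon> C (insert p Y) (reps @ [p]) (cnts @ [1])"
proof -
  let ?m = "length reps"
  from inv obtain \<phi> where \<phi>: "\<forall>p\<in>Y. \<phi> p < ?m \<and> close \<epsilon> C (reps ! \<phi> p) p"
      "\<forall>v<?m. cnts ! v = card {p \<in> Y. \<phi> p = v}"
    by (auto simp: invariant_def)
  have "{q \<in> insert p Y. (\<phi>(p := ?m)) q = u} = (if u = ?m then {p} else {q \<in> Y. \<phi> q = u})"
    if "u \<le> ?m" for u
    using \<open>p \<notin> Y\<close> \<phi>(1) that by auto
  then have "\<forall>u<length (reps @ [p]). (cnts @ [1]) ! u = card {q \<in> insert p Y. (\<phi>(p := ?m)) q = u}"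
    using inv \<phi>(2) by (auto simp: nth_append less_Suc_eq_le le_less invariant_def)
  moreover have "\<forall>q\<in>insert p Y. (\<phi>(p := ?m)) q < length (reps @ [p]) \<and>
      close \<epsilon> C ((reps @ [p]) ! (\<phi>(p := ?m)) q) q"
    using \<phi>(1) close_refl[OF \<open>0 < \<epsilon>\<close>] \<open>p \<notin> Y\<close> by (auto simp: nth_append less_Suc_eq)
  moreover have "\<forall>v<length (reps @ [p]). \<forall>u<v. \<not> close \<epsilon> C ((reps @ [p]) ! u) ((reps @ [p]) ! v)"
    using inv new by (auto simp: invariant_def nth_append less_Suc_eq)
  ultimately show ?thesis
    using inv \<open>p \<notin> Y\<close> unfolding invariant_def
    by (intro conjI exI[of _ "\<phi>(p := ?m)"]) auto
qed

text \<open>Of two representatives the older one is not close to the younger one, which refutes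
  closeness in both directions.\<close>

lemma invariant_separated:
  assumes "invariant \<epsilon> C Y reps cnts" "p \<in> set reps" "q \<in> set reps" "p \<noteq> q"
  shows "\<not> (close \<epsilon> C p q \<and> close \<epsilon> C q p)"
proof -
  obtain u v where "u < length reps" "v < length reps" "p = reps ! u" "q = reps ! v"
    using assms by (auto simp: in_set_conv_nth)
  then show ?thesis
    using assms(1,4) by (cases u v rule: linorder_cases) (auto simp: invariant_def)
qed

section \<open>Execution of the programs, for an abstract bound \<open>M\<close> on the size of
  incompatible sets\<close>

locale run =
  fixes \<epsilon> :: real and cs :: "point list" and X :: "point set" and n M k :: nat
  assumes eps: "0 < \<epsilon>" and X: "finite X" "card X = n" and k: "k = length cs" "1 \<le> k"
    and M: "\<And>R. R \<subseteq> X \<Longrightarrow> (\<And>p q. p \<in> R \<Longrightarrow> q \<in> R \<Longrightarrow> p \<noteq> q \<Longrightarrow>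
                \<not> (close \<epsilon> (set cs) p q \<and> close \<epsilon> (set cs) q p)) \<Longrightarrow> card R \<le> M"
begin

abbreviation "conf \<equiv> config n M k"
abbreviation "env_at p \<equiv> \<lparr>centers = cs, eps = \<epsilon>, current = Some p\<rparr>"

text \<open>These are the bounds that \<open>fits\<close> demands: representatives are distinct,
  incompatible points of \<open>X\<close>, and each counter is the size of a subset of
  \<open>X\<close>.\<close>

lemma invariant_bounds:
  assumes inv: "invariant \<epsilon> (set cs) Y reps cnts" and Y: "Y \<subseteq> X"
  shows "length reps \<le> n" "length reps \<le> M" "\<forall>x\<in>set cnts. x \<le> n"
proof -
  have card: "card (set reps) = length reps"
    using inv by (simp add: invariant_def distinct_card)
  have sub: "set reps \<subseteq> X" using inv Y by (auto simp: invariant_def)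
  show "length reps \<le> n" using card_mono[OF X(1) sub] X card by simp
  show "length reps \<le> M" using M[OF sub] invariant_separated[OF inv] card by metis
  have "card {p \<in> Y. P p} \<le> n" for P
    unfolding X(2)[symmetric] using Y by (intro card_mono X) auto
  then show "\<forall>x\<in>set cnts. x \<le> n"
    using inv by (auto simp: invariant_def in_set_conv_nth)
qed

lemma exec_NStore:
  assumes "conf m v j cnts ws \<sigma>" "store (nats \<sigma>) (nval \<Gamma> \<sigma> a) (nval \<Gamma> \<sigma> b) = m' # 5 # 0 # v' # j' # cnts'"
    and "fits n M k m' v' j' cnts' ws"
  obtains \<sigma>' where "exec \<Gamma> (NStore a b) \<sigma> \<sigma>'" "conf m' v' j' cnts' ws \<sigma>'"
proof (rule that[OF exec.NStore])
  show "conf m' v' j' cnts' ws (touch (\<sigma>\<lparr>nats := store (nats \<sigma>) (nval \<Gamma> \<sigma> a) (nval \<Gamma> \<sigma> b)\<rparr>))"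
    using assms k by (intro config_touch) (auto simp: config_def)
qed

lemma exec_RStore:
  assumes "conf m v j cnts ws \<sigma>" "store ws (nval \<Gamma> \<sigma> a) (rval \<Gamma> \<sigma> r) = ws'"
    and "fits n M k m v j cnts ws'"
  obtains \<sigma>' where "exec \<Gamma> (RStore a r) \<sigma> \<sigma>'" "conf m v j cnts ws' \<sigma>'"
proof (rule that[OF exec.RStore])
  show "conf m v j cnts ws' (touch (\<sigma>\<lparr>reals := store (reals \<sigma>) (nval \<Gamma> \<sigma> a) (rval \<Gamma> \<sigma> r)\<rparr>))"
    using assms k by (intro config_touch) (auto simp: config_def)
qed

lemma bval_agrees:
  assumes "conf (length reps) v j cnts (concat (map (weight_row cs) reps)) \<sigma>"
    and "v < length reps" "j < k"
  shows "bval (env_at p) \<sigma> agrees \<longleftrightarrow>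
    (1 - \<epsilon>) * (edist p (cs ! j))\<^sup>2 \<le> (edist (reps ! v) (cs ! j))\<^sup>2 \<and>
    (edist (reps ! v) (cs ! j))\<^sup>2 \<le> (1 + \<epsilon>) * (edist p (cs ! j))\<^sup>2"
proof -
  have "v * length cs + j < length reps * length cs"
  proof -
    have "v * length cs + j < Suc v * length cs" using assms k by simp
    also have "\<dots> \<le> length reps * length cs" using assms by (intro mult_right_mono) auto
    finally show ?thesis .
  qed
  then have "fetch (reals \<sigma>) (v * length cs + j) = (edist (reps ! v) (cs ! j))\<^sup>2"
    using assms nth_rows[of v reps j cs] k by (simp add: config_def fetch_def length_rows)
  then show ?thesis
    using assms k by (simp add: agrees_def config_def not_less)
qed

lemma close_iff_nth:
  "close \<epsilon> (set cs) q p \<longleftrightarrow> (\<forall>i<k. (1 - \<epsilon>) * (edist p (cs ! i))\<^sup>2 \<le> (edist q (cs ! i))\<^sup>2 \<and>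
     (edist q (cs ! i))\<^sup>2 \<le> (1 + \<epsilon>) * (edist p (cs ! i))\<^sup>2)"
  unfolding close_def k by (rule all_set_conv_all_nth)

text \<open>Stated for an arbitrary intermediate state of the loop: the vertices before
  \<open>v\<close> are refuted and the centers before \<open>j\<close> agree at \<open>v\<close>. A
  fruitless search ends with center index 0, where writing the new row has to begin.\<close>

lemma exec_search:
  fixes reps
  defines "m \<equiv> length reps" and "ws \<equiv> concat (map (weight_row cs) reps)"
  assumes "conf m v j cnts ws \<sigma>" "v \<le> m" "v = m \<Longrightarrow> j = 0"
    and "\<forall>u<v. \<not> close \<epsilon> (set cs) (reps ! u) p"
    and "\<forall>i<j. (1 - \<epsilon>) * (edist p (cs ! i))\<^sup>2 \<le> (edist (reps ! v) (cs ! i))\<^sup>2 \<and>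
               (edist (reps ! v) (cs ! i))\<^sup>2 \<le> (1 + \<epsilon>) * (edist p (cs ! i))\<^sup>2"
  shows "\<exists>\<sigma>' v' j'. exec (env_at p) search \<sigma> \<sigma>' \<and> conf m v' j' cnts ws \<sigma>' \<and> v' \<le> m \<and>
    (\<forall>u<v'. \<not> close \<epsilon> (set cs) (reps ! u) p) \<and>
    (v' < m \<longrightarrow> close \<epsilon> (set cs) (reps ! v') p) \<and> (v' = m \<longrightarrow> j' = 0)"
  using assms(3-)
\<comment> \<open>Moving to the next vertex resets \<open>j\<close> and so raises
  \<open>k - j\<close> by at most \<open>k\<close>, which the weight \<open>k + 1\<close> of a
  vertex outdoes.\<close>
proof (induction "(m - v) * (k + 1) + (k - j)" arbitrary: \<sigma> v j rule: less_induct)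
  case less
  have fits: "fits n M k m v j cnts ws" and \<sigma>: "nats \<sigma> = m # 5 # 0 # v # j # cnts"
    using less.prems(1) by (auto simp: config_def)
  let ?b = "And (NLess vertex num_vertices) (NLess center NumCenters)"
  show ?case
  proof (cases "v < m \<and> j < k")
    case False
    then have "\<not> bval (env_at p) \<sigma> ?b" using \<sigma> k by simp
    then have "exec (env_at p) search \<sigma> \<sigma>" unfolding search_def by (rule exec.WhileFalse)
    moreover have "close \<epsilon> (set cs) (reps ! v) p" if "v < m"
    proof -
      have "j = k" using that False fits by (auto simp: fits_def)
      then show ?thesis using less.prems(5) by (simp add: close_iff_nth)
    qed
    ultimately show ?thesis using less.prems by blast
  next
    case True
    then have b: "bval (env_at p) \<sigma> ?b" using \<sigma> k by simp
    have agrees: "bval (env_at p) \<sigma> agrees \<longleftrightarrow>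
        (1 - \<epsilon>) * (edist p (cs ! j))\<^sup>2 \<le> (edist (reps ! v) (cs ! j))\<^sup>2 \<and>
        (edist (reps ! v) (cs ! j))\<^sup>2 \<le> (1 + \<epsilon>) * (edist p (cs ! j))\<^sup>2"
      using less.prems(1) True bval_agrees unfolding m_def ws_def by blast
    show ?thesis
    proof (cases "bval (env_at p) \<sigma> agrees")
      case yes: True
      obtain \<sigma>' where \<sigma>': "exec (env_at p) (NStore (NConst 4) (NAdd center (NConst 1))) \<sigma> \<sigma>'"
          "conf m v (j + 1) cnts ws \<sigma>'"
        by (rule exec_NStore[OF less.prems(1), where m' = m and v' = v and j' = "j + 1" and cnts' = cnts])
          (use fits True \<sigma> in \<open>auto simp: fits_def\<close>)
      have "\<exists>\<sigma>'' v' j'. exec (env_at p) search \<sigma>' \<sigma>'' \<and> conf m v' j' cnts ws \<sigma>'' \<and> v' \<le> m \<and>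
          (\<forall>u<v'. \<not> close \<epsilon> (set cs) (reps ! u) p) \<and>
          (v' < m \<longrightarrow> close \<epsilon> (set cs) (reps ! v') p) \<and> (v' = m \<longrightarrow> j' = 0)"
      proof (rule less.hyps[OF _ \<sigma>'(2)])
        show "(m - v) * (k + 1) + (k - (j + 1)) < (m - v) * (k + 1) + (k - j)"
          using True by (intro add_strict_left_mono diff_less_mono2) auto
      qed (use less.prems True agrees yes in \<open>auto simp: less_Suc_eq\<close>)
      moreover have "exec (env_at p) search \<sigma> \<sigma>''" if "exec (env_at p) search \<sigma>' \<sigma>''" for \<sigma>''
        using that b yes \<sigma>'(1) unfolding search_def by (blast intro: exec.intros)
      ultimately show ?thesis by blast
    next
      case no: False
      obtain \<sigma>1 where \<sigma>1: "exec (env_at p) (NStore (NConst 3) (NAdd vertex (NConst 1))) \<sigma> \<sigma>1"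
          "conf m (v + 1) j cnts ws \<sigma>1"
        by (rule exec_NStore[OF less.prems(1), where m' = m and v' = "v + 1" and j' = j and cnts' = cnts])
          (use fits True \<sigma> in \<open>auto simp: fits_def\<close>)
      obtain \<sigma>' where \<sigma>': "exec (env_at p) (NStore (NConst 4) (NConst 0)) \<sigma>1 \<sigma>'"
          "conf m (v + 1) 0 cnts ws \<sigma>'"
        by (rule exec_NStore[OF \<sigma>1(2), where m' = m and v' = "v + 1" and j' = 0 and cnts' = cnts])
          (use \<sigma>1(2) in \<open>auto simp: fits_def config_def\<close>)
      have "\<not> close \<epsilon> (set cs) (reps ! v) p"
        using no agrees True by (auto simp: close_iff_nth)
      then have no': "\<forall>u<v + 1. \<not> close \<epsilon> (set cs) (reps ! u) p"
        using less.prems(4) by (auto simp: less_Suc_eq)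
      have "\<exists>\<sigma>'' v' j'. exec (env_at p) search \<sigma>' \<sigma>'' \<and> conf m v' j' cnts ws \<sigma>'' \<and> v' \<le> m \<and>
          (\<forall>u<v'. \<not> close \<epsilon> (set cs) (reps ! u) p) \<and>
          (v' < m \<longrightarrow> close \<epsilon> (set cs) (reps ! v') p) \<and> (v' = m \<longrightarrow> j' = 0)"
      proof (rule less.hyps[OF _ \<sigma>'(2)])
        have "m - v = Suc (m - (v + 1))" using True by linarith
        then show "(m - (v + 1)) * (k + 1) + (k - 0) < (m - v) * (k + 1) + (k - j)"
          by simp
      qed (use True no' in auto)
      moreover have "exec (env_at p) search \<sigma> \<sigma>''" if "exec (env_at p) search \<sigma>' \<sigma>''" for \<sigma>''
        using that b no \<sigma>1(1) \<sigma>'(1) unfolding search_def by (blast intro: exec.intros)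
      ultimately show ?thesis by blast
    qed
  qed
qed

text \<open>Since exactly \<open>v\<close> full rows precede, the weight address is always the first
  free cell, and each store extends the array by one entry without padding. \<open>v < M\<close>
  leaves room for the row.\<close>

lemma exec_write_row:
  assumes "conf m v j cnts (ws @ take j (weight_row cs p)) \<sigma>" "length ws = v * k"
    and "v < M"
  shows "\<exists>\<sigma>'. exec (env_at p) write_row \<sigma> \<sigma>' \<and> conf m v k cnts (ws @ weight_row cs p) \<sigma>'"
  using assms(1)
proof (induction "k - j" arbitrary: \<sigma> j rule: less_induct)
  case less
  have fits: "fits n M k m v j cnts (ws @ take j (weight_row cs p))"
    and \<sigma>: "nats \<sigma> = m # 5 # 0 # v # j # cnts"
    using less.prems(1) by (auto simp: config_def)
  have len: "length (weight_row cs p) = k" by (simp add: weight_row_def k)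
  show ?case
  proof (cases "j < k")
    case False
    then have "\<not> bval (env_at p) \<sigma> (NLess center NumCenters)" "j = k"
      using \<sigma> k fits by (auto simp: fits_def)
    then show ?thesis
      using less.prems len unfolding write_row_def by (auto intro!: exI[of _ \<sigma>] exec.WhileFalse)
  next
    case True
    let ?ws' = "ws @ take (j + 1) (weight_row cs p)"
    have "v * k + k \<le> M * k" using mult_le_mono1[of "v + 1" M k] assms(3) by simp
    then have fits': "fits n M k m v j cnts ?ws'"
      using fits True len assms(2) by (simp add: fits_def)
    have app: "?ws' = (ws @ take j (weight_row cs p)) @ [(edist p (cs ! j))\<^sup>2]"
      using True by (simp add: take_Suc_conv_app_nth len) (simp add: weight_row_def k)
    obtain \<sigma>1 where \<sigma>1: "exec (env_at p) (RStore weight_address (SqDist center)) \<sigma> \<sigma>1"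
        "conf m v j cnts ?ws' \<sigma>1"
    proof (rule exec_RStore[OF less.prems _ fits'])
      have "v * length cs + j = length (ws @ take j (weight_row cs p))"
        using True assms(2) len k by simp
      then show "store (ws @ take j (weight_row cs p)) (nval (env_at p) \<sigma> weight_address)
          (rval (env_at p) \<sigma> (SqDist center)) = ?ws'"
        using True k unfolding app by (simp add: \<sigma> store_end del: length_append)
    qed
    obtain \<sigma>2 where \<sigma>2: "exec (env_at p) (NStore (NConst 4) (NAdd center (NConst 1))) \<sigma>1 \<sigma>2"
        "conf m v (j + 1) cnts ?ws' \<sigma>2"
      by (rule exec_NStore[OF \<sigma>1(2), where m' = m and v' = v and j' = "j + 1" and cnts' = cnts])
        (use \<sigma>1(2) True in \<open>auto simp: fits_def config_def\<close>)
    obtain \<sigma>' where \<sigma>': "exec (env_at p) write_row \<sigma>2 \<sigma>'" "conf m v k cnts (ws @ weight_row cs p) \<sigma>'"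
      using less.hyps[OF diff_less_mono2 \<sigma>2(2)] True by auto
    have "bval (env_at p) \<sigma> (NLess center NumCenters)" using True k \<sigma> by simp
    then have "exec (env_at p) write_row \<sigma> \<sigma>'"
      using \<sigma>1(1) \<sigma>2(1) \<sigma>'(1) unfolding write_row_def by (blast intro: exec.intros)
    then show ?thesis using \<sigma>'(2) by blast
  qed
qed

lemma exec_insert_point:
  assumes conf: "conf (length reps) v\<^sub>0 j\<^sub>0 cnts (concat (map (weight_row cs) reps)) \<sigma>"
    and inv: "invariant \<epsilon> (set cs) Y reps cnts" and p: "p \<notin> Y" "insert p Y \<subseteq> X"
  shows "\<exists>\<sigma>' v' j' reps' cnts'. exec (env_at p) insert_point \<sigma> \<sigma>' \<and>
    conf (length reps') v' j' cnts' (concat (map (weight_row cs) reps')) \<sigma>' \<and>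
    invariant \<epsilon> (set cs) (insert p Y) reps' cnts'"
proof -
  let ?m = "length reps" and ?ws = "concat (map (weight_row cs) reps)"
  have finY: "finite Y" using p X finite_subset by auto
  have lenc: "length cnts = ?m" using inv by (simp add: invariant_def)
  obtain \<sigma>1 where \<sigma>1: "exec (env_at p) (NStore (NConst 3) (NConst 0)) \<sigma> \<sigma>1" "conf ?m 0 j\<^sub>0 cnts ?ws \<sigma>1"
    by (rule exec_NStore[OF conf, where m' = ?m and v' = 0 and j' = j\<^sub>0 and cnts' = cnts])
      (use conf in \<open>auto simp: fits_def config_def\<close>)
  obtain \<sigma>2 where \<sigma>2: "exec (env_at p) (NStore (NConst 4) (NConst 0)) \<sigma>1 \<sigma>2" "conf ?m 0 0 cnts ?ws \<sigma>2"
    by (rule exec_NStore[OF \<sigma>1(2), where m' = ?m and v' = 0 and j' = 0 and cnts' = cnts])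
      (use \<sigma>1(2) in \<open>auto simp: fits_def config_def\<close>)
  obtain \<sigma>3 v j where \<sigma>3: "exec (env_at p) search \<sigma>2 \<sigma>3" "conf ?m v j cnts ?ws \<sigma>3" and v: "v \<le> ?m"
      "\<forall>u<v. \<not> close \<epsilon> (set cs) (reps ! u) p" "v < ?m \<longrightarrow> close \<epsilon> (set cs) (reps ! v) p"
      "v = ?m \<longrightarrow> j = 0"
    using exec_search[OF \<sigma>2(2), of p] by auto
  have n3: "nats \<sigma>3 = ?m # 5 # 0 # v # j # cnts" using \<sigma>3(2) by (simp add: config_def)
  let ?incr = "NStore counter (NAdd (NLoad counter) (NConst 1))"
  show ?thesis
  proof (cases "v < ?m")
    case True
    let ?cnts = "cnts[v := cnts ! v + 1]"
    have inv': "invariant \<epsilon> (set cs) (insert p Y) reps ?cnts"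
      using invariant_join[OF inv finY p(1)] True v by simp
    obtain \<sigma>4 where \<sigma>4: "exec (env_at p) ?incr \<sigma>3 \<sigma>4" "conf ?m v j ?cnts ?ws \<sigma>4"
    proof (rule exec_NStore[OF \<sigma>3(2)])
      show "store (nats \<sigma>3) (nval (env_at p) \<sigma>3 counter) (nval (env_at p) \<sigma>3 (NAdd (NLoad counter) (NConst 1)))
          = ?m # 5 # 0 # v # j # ?cnts"
        using True lenc by (simp add: n3) (simp add: fetch_def store_def)
      show "fits n M k ?m v j ?cnts ?ws"
        using invariant_bounds[OF inv' p(2)] \<sigma>3(2) by (simp add: config_def fits_def)
    qed
    have "bval (env_at p) \<sigma>4 (NLess vertex num_vertices)"
      using \<sigma>4(2) True by (simp add: config_def)
    then have "exec (env_at p) insert_point \<sigma> \<sigma>4"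
      using \<sigma>1(1) \<sigma>2(1) \<sigma>3(1) \<sigma>4(1) unfolding insert_point_def by (blast intro: exec.intros)
    then show ?thesis using \<sigma>4(2) inv' by blast
  next
    case False
    then have vm: "v = ?m" "j = 0" using v by auto
    let ?cnts = "cnts @ [1]"
    \<comment> \<open>Established ahead of the execution: it bounds the enlarged lists by
      \<open>n\<close> and \<open>M\<close>, and hence all memories in between.\<close>
    have inv': "invariant \<epsilon> (set cs) (insert p Y) (reps @ [p]) ?cnts"
      using invariant_new[OF inv p(1) eps] v vm by simp
    note bounds = invariant_bounds[OF inv' p(2)]
    have rows: "length ?ws = ?m * k" by (simp add: length_rows k)
    have "?m * k \<le> M * k" using bounds by (intro mult_right_mono) auto
    then have fits: "fits n M k ?m v j ?cnts ?ws"
      using bounds vm lenc rows by (simp add: fits_def)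
    obtain \<sigma>4 where \<sigma>4: "exec (env_at p) ?incr \<sigma>3 \<sigma>4" "conf ?m v j ?cnts ?ws \<sigma>4"
    proof (rule exec_NStore[OF \<sigma>3(2) _ fits])
      show "store (nats \<sigma>3) (nval (env_at p) \<sigma>3 counter) (nval (env_at p) \<sigma>3 (NAdd (NLoad counter) (NConst 1)))
          = ?m # 5 # 0 # v # j # ?cnts"
        using vm lenc by (simp add: n3) (simp add: fetch_def store_def)
    qed
    obtain \<sigma>5 where \<sigma>5: "exec (env_at p) write_row \<sigma>4 \<sigma>5"
        "conf ?m v k ?cnts (?ws @ weight_row cs p) \<sigma>5"
      using exec_write_row[of ?m v 0 ?cnts ?ws p \<sigma>4] \<sigma>4(2) vm bounds rows by auto
    obtain \<sigma>6 where \<sigma>6: "exec (env_at p) (NStore (NConst 0) (NAdd num_vertices (NConst 1))) \<sigma>5 \<sigma>6"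
        "conf (?m + 1) v k ?cnts (?ws @ weight_row cs p) \<sigma>6"
      by (rule exec_NStore[OF \<sigma>5(2), where m' = "?m + 1" and v' = v and j' = k and cnts' = ?cnts])
        (use \<sigma>5(2) bounds in \<open>auto simp: fits_def config_def\<close>)
    have "\<not> bval (env_at p) \<sigma>4 (NLess vertex num_vertices)"
      using \<sigma>4(2) vm by (simp add: config_def)
    then have "exec (env_at p) insert_point \<sigma> \<sigma>6"
      using \<sigma>1(1) \<sigma>2(1) \<sigma>3(1) \<sigma>4(1) \<sigma>5(1) \<sigma>6(1) unfolding insert_point_def
      by (blast intro: exec.intros)
    moreover have "conf (length (reps @ [p])) v k ?cnts (concat (map (weight_row cs) (reps @ [p]))) \<sigma>6"
      using \<sigma>6(2) by simp
    ultimately show ?thesis using inv' by blast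
  qed
qed

lemma feed_insert_point:
  assumes "conf (length reps) v j cnts (concat (map (weight_row cs) reps)) \<sigma>"
    and "invariant \<epsilon> (set cs) Y reps cnts" "distinct xs" "Y \<inter> set xs = {}" "Y \<union> set xs \<subseteq> X"
  shows "\<exists>\<sigma>' v' j' reps' cnts'.
    feed \<lparr>centers = cs, eps = \<epsilon>, current = None\<rparr> insert_point xs \<sigma> \<sigma>' \<and>
    conf (length reps') v' j' cnts' (concat (map (weight_row cs) reps')) \<sigma>' \<and>
    invariant \<epsilon> (set cs) (Y \<union> set xs) reps' cnts'"
  using assms
proof (induction xs arbitrary: Y reps v j cnts \<sigma>)
  case Nil
  then show ?case using feed.intros(1) by fastforce
next
  case (Cons p xs)
  have "p \<notin> Y" "insert p Y \<subseteq> X" using Cons.prems by auto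
  then obtain \<sigma>1 v1 j1 reps1 cnts1 where 1: "exec (env_at p) insert_point \<sigma> \<sigma>1"
      "conf (length reps1) v1 j1 cnts1 (concat (map (weight_row cs) reps1)) \<sigma>1"
      "invariant \<epsilon> (set cs) (insert p Y) reps1 cnts1"
    using exec_insert_point[OF Cons.prems(1,2)] by blast
  have "insert p Y \<inter> set xs = {}" "insert p Y \<union> set xs \<subseteq> X" "distinct xs"
    using Cons.prems by auto
  from Cons.IH[OF 1(2,3) this(3,1,2)] show ?case
    using 1(1) by (fastforce intro: feed.intros)
qed

lemma initial_config:
  "\<exists>\<sigma>. exec \<Gamma> (initialize greedy) empty_state \<sigma> \<and> conf 0 0 0 [] [] \<sigma>"
proof -
  let ?\<sigma>1 = "touch (empty_state\<lparr>nats := [0, 5]\<rparr>)"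
  have "exec \<Gamma> (NStore (NConst 1) (NConst 5)) empty_state ?\<sigma>1"
    using exec.NStore[of \<Gamma> "NConst 1" "NConst 5" empty_state]
    by (simp add: store_def empty_state_def)
  moreover have "exec \<Gamma> (NStore (NConst 4) (NConst 0)) ?\<sigma>1
      (touch (?\<sigma>1\<lparr>nats := [0, 5, 0, 0, 0]\<rparr>))"
    using exec.NStore[of \<Gamma> "NConst 4" "NConst 0" ?\<sigma>1]
    by (simp add: store_def touch_def numeral_eq_Suc)
  moreover have "conf 0 0 0 [] [] (touch (?\<sigma>1\<lparr>nats := [0, 5, 0, 0, 0]\<rparr>))"
    using k(2) by (intro config_touch)
      (auto simp: fits_def touch_def empty_state_def space_def space_cap_def bits_small)
  ultimately show ?thesis by (auto simp: greedy_def intro: exec.intros)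
qed

text \<open>The weights are the exact squared distances of the representatives, so
  \<open>close\<close> is the accuracy required of the edges, and the assignment of the invariant
  serves as the map to the vertices.\<close>

lemma represents_invariant:
  assumes conf: "conf (length reps) v j cnts (concat (map (weight_row cs) reps)) \<sigma>"
    and inv: "invariant \<epsilon> (set cs) X reps cnts" and cs: "distinct cs"
  shows "graph_in_memory cs \<sigma>" "represents \<epsilon> (graph_of cs \<sigma>) X (set cs)"
proof -
  have \<sigma>: "nats \<sigma> = length reps # 5 # 0 # v # j # cnts" "reals \<sigma> = concat (map (weight_row cs) reps)"
    using conf by (auto simp: config_def)
  have lenc: "length cnts = length reps" using inv by (simp add: invariant_def)
  show "graph_in_memory cs \<sigma>"
    by (simp add: graph_in_memory_def \<sigma> length_rows lenc numeral_2_eq_2)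
  from inv obtain \<phi> where \<phi>: "\<forall>p\<in>X. \<phi> p < length reps \<and> close \<epsilon> (set cs) (reps ! \<phi> p) p"
      "\<forall>v<length reps. cnts ! v = card {p \<in> X. \<phi> p = v}"
    by (auto simp: invariant_def)
  \<comment> \<open>Distinctness of the centers makes the column index well defined.\<close>
  have "(THE i. i < length cs \<and> cs ! i = cs ! l) = l" if "l < length cs" for l
    using that cs by (intro the_equality) (auto simp: nth_eq_iff_index_eq)
  then have weight: "weight (graph_of cs \<sigma>) (u, c) = (edist (reps ! u) c)\<^sup>2"
    if "u < length reps" "c \<in> set cs" for u c
    using that by (auto simp: graph_of_def \<sigma> nth_rows in_set_conv_nth numeral_2_eq_2)
  have num: "num (graph_of cs \<sigma>) u = cnts ! u" for u
    by (simp add: graph_of_def \<sigma> numeral_eq_Suc)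
  have sets: "left (graph_of cs \<sigma>) = {..<length reps}" "right (graph_of cs \<sigma>) = set cs"
    "edges (graph_of cs \<sigma>) = {..<length reps} \<times> set cs"
    by (simp_all add: graph_of_def \<sigma>)
  show "represents \<epsilon> (graph_of cs \<sigma>) X (set cs)"
    unfolding represents_def wf_wbigraph_def sets
    using \<phi> by (intro conjI exI[of _ \<phi>]) (auto simp: weight num close_def)
qed

lemma greedy_correct:
  assumes "distinct xs" "set xs = X" "distinct cs"
  shows "\<exists>\<sigma>. single_pass greedy \<epsilon> cs xs \<sigma> \<and> graph_in_memory cs \<sigma> \<and>
    represents \<epsilon> (graph_of cs \<sigma>) X (set cs) \<and> peak \<sigma> \<le> space_cap n M k"
proof -
  let ?\<Gamma> = "\<lparr>centers = cs, eps = \<epsilon>, current = None\<rparr>"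
  obtain \<sigma>1 where \<sigma>1: "exec ?\<Gamma> (initialize greedy) empty_state \<sigma>1" "conf 0 0 0 [] [] \<sigma>1"
    using initial_config by blast
  have "invariant \<epsilon> (set cs) {} [] []" by (simp add: invariant_def)
  then obtain \<sigma> v j reps cnts where \<sigma>: "feed ?\<Gamma> insert_point xs \<sigma>1 \<sigma>"
      "conf (length reps) v j cnts (concat (map (weight_row cs) reps)) \<sigma>"
      "invariant \<epsilon> (set cs) X reps cnts"
    using feed_insert_point[of "[]" 0 0 "[]" \<sigma>1 "{}" xs] \<sigma>1(2) assms by auto
  have "single_pass greedy \<epsilon> cs xs \<sigma>"
    using \<sigma>1(1) \<sigma>(1) exec.Skip unfolding single_pass_def Let_def by (fastforce simp: greedy_def)
  then show ?thesis
    using represents_invariant[OF \<sigma>(2,3) assms(3)] \<sigma>(2) by (auto simp: config_def)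
qed

end

subsection \<open>The space bound\<close>

text \<open>This absorbs exponential constants into \<open>k ^ k\<close>. By k^2 \<le> 4^k the left
  side is at most \<open>A ^ k\<close>; this is at most \<open>A ^ N\<close> if
  \<open>k \<le> N\<close>, and at most \<open>k ^ k\<close> otherwise, as then
  \<open>A \<le> k\<close>.\<close>

lemma sq_times_power_le:
  fixes c :: real
  assumes "0 \<le> c"
  obtains K where "0 \<le> K" "\<And>k :: nat. 1 \<le> k \<Longrightarrow> (real k)\<^sup>2 * c ^ k \<le> K * real k ^ k"
proof -
  define A where "A = max 1 (4 * c)"
  define N where "N = nat \<lceil>A\<rceil>"
  have A: "1 \<le> A" "4 * c \<le> A" "A \<le> real N" by (auto simp: A_def N_def)
  have "(real k)\<^sup>2 * c ^ k \<le> A ^ N * real k ^ k" if "1 \<le> k" for k :: nat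
  proof -
    have "real k \<le> 2 ^ k" by (rule less_imp_le[OF of_nat_less_two_power])
    then have "(real k)\<^sup>2 \<le> (2 ^ k)\<^sup>2" by (rule power_mono) simp
    also have "(2 ^ k)\<^sup>2 = (2\<^sup>2 :: real) ^ k" by (metis power_mult mult.commute)
    also have "(2\<^sup>2 :: real) = 4" by simp
    finally have "(real k)\<^sup>2 * c ^ k \<le> 4 ^ k * c ^ k" using assms by (intro mult_right_mono) auto
    also have "\<dots> = (4 * c) ^ k" by (rule power_mult_distrib[symmetric])
    also have "\<dots> \<le> A ^ k" using A assms by (intro power_mono) auto
    also have "\<dots> \<le> A ^ N * real k ^ k"
    proof (cases "k \<le> N")
      case True
      then have "A ^ k * 1 \<le> A ^ N * real k ^ k"
        using A that by (intro mult_mono power_increasing one_le_power) auto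
      then show ?thesis by simp
    next
      case False
      then have "1 * A ^ k \<le> A ^ N * real k ^ k"
        using A by (intro mult_mono power_mono one_le_power) auto
      then show ?thesis by simp
    qed
    finally show ?thesis .
  qed
  then show thesis using that[of "A ^ N"] A by simp
qed

text \<open>Up to constants, \<open>g - 1\<close> is at least \<epsilon>, and the logarithm to base
  \<open>g\<close> is 4 times that to base \<open>1 + \<epsilon>\<close>. Additive constants are
  absorbed by \<open>ln (1 / \<epsilon>)\<close>, which is at least the positive number
  \<open>ln (1 / \<epsilon>\<^sub>0)\<close>; this is why \<epsilon> has to stay away from
  1.\<close>

lemma width_le:
  assumes "0 < \<epsilon>" "\<epsilon> \<le> \<epsilon>\<^sub>0" "\<epsilon>\<^sub>0 < 1" and g: "1 < g" "g ^ 4 = 1 + \<epsilon>" "g \<le> 2"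
  shows "width g \<le> ((8 * ln 90 + 1) / ln (1 / \<epsilon>\<^sub>0) + 8) * log (1 + \<epsilon>) (1 / \<epsilon>)"
proof -
  define h where "h = g - 1"
  have h: "0 < h" "h \<le> 1" "g = 1 + h" using g by (auto simp: h_def)
  \<comment> \<open>All powers of \<open>h\<close> in the expansion are replaced by
    \<open>h\<close>, and 4 + 6 + 4 + 1 = 15; then 6 * 15 = 90.\<close>
  have "h ^ 2 \<le> h" "h ^ 3 \<le> h" "h ^ 4 \<le> h"
    using h power_decreasing[of 1 _ h] by auto
  moreover have "g ^ 4 = 1 + 4 * h + 6 * h ^ 2 + 4 * h ^ 3 + h ^ 4"
    by (simp add: h(3) power2_eq_square power3_eq_cube power4_eq_xxxx algebra_simps)
  ultimately have "\<epsilon> \<le> 15 * h" using g by linarith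
  then have "90 / (15 * h) \<le> 90 / \<epsilon>"
    using h assms by (intro divide_left_mono) auto
  then have "6 / h \<le> 90 * (1 / \<epsilon>)" by simp
  then have "log g (6 / h) \<le> log g (90 * (1 / \<epsilon>))"
    using g h by (subst log_le_cancel_iff) (auto simp: assms)
  also have "\<dots> = 4 * (ln 90 + ln (1 / \<epsilon>)) / ln (1 + \<epsilon>)"
  proof -
    have "ln (1 + \<epsilon>) = 4 * ln g" unfolding g(2)[symmetric] using g(1) by (simp add: ln_realpow)
    moreover have "ln (90 * (1 / \<epsilon>)) = ln 90 + ln (1 / \<epsilon>)" using assms(1) by (simp add: ln_div)
    ultimately show ?thesis by (simp add: log_def add_divide_distrib)
  qed
  finally have w: "width g \<le> 8 * (ln 90 + ln (1 / \<epsilon>)) / ln (1 + \<epsilon>) + 1"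
    by (simp add: width_def h_def add_divide_distrib)
  have e: "0 < ln (1 + \<epsilon>)" "ln (1 + \<epsilon>) \<le> 1"
    using assms ln_add_one_self_le_self[of \<epsilon>] by auto
  have l: "0 < ln (1 / \<epsilon>\<^sub>0)" "ln (1 / \<epsilon>\<^sub>0) \<le> ln (1 / \<epsilon>)"
    using assms by (auto simp: ln_div)
  have "1 * (8 * ln 90 + 1) \<le> (ln (1 / \<epsilon>) / ln (1 / \<epsilon>\<^sub>0)) * (8 * ln 90 + 1)"
    using l by (intro mult_right_mono) (auto simp: add_nonneg_nonneg)
  then have "8 * (ln 90 + ln (1 / \<epsilon>)) + 1 \<le> ((8 * ln 90 + 1) / ln (1 / \<epsilon>\<^sub>0) + 8) * ln (1 / \<epsilon>)"
    by (simp add: algebra_simps add_divide_distrib)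
  then have "(8 * (ln 90 + ln (1 / \<epsilon>)) + 1) / ln (1 + \<epsilon>)
      \<le> ((8 * ln 90 + 1) / ln (1 / \<epsilon>\<^sub>0) + 8) * log (1 + \<epsilon>) (1 / \<epsilon>)"
    using e by (simp add: divide_right_mono log_def)
  \<comment> \<open>This puts the summand 1 of the width over the common denominator.\<close>
  moreover have "1 \<le> 1 / ln (1 + \<epsilon>)" using e by simp
  ultimately show ?thesis using w by (simp add: add_divide_distrib)
qed

text \<open>The parameters \<open>c\<close> and \<open>c'\<close> hide the change from base
  \<open>g\<close> to base \<open>b\<close>. The logarithm of \<open>Delta\<close> may be 0, so
  additive terms are charged to the second summand of the space bound, through
  \<open>k \<le> W \<le> K * Y\<close>.\<close>

lemma greedy_builds_representation:
  assumes pc: "points_and_centers d n k X C" and \<epsilon>: "0 < \<epsilon>" "\<epsilon> < 1"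
    and g: "1 < g" "g \<le> 2" "g ^ 4 = 1 + \<epsilon>" and b: "1 < b"
    and width: "width g \<le> c * log b (1 / \<epsilon>)" "0 \<le> c"
    and Delta: "log g (Delta X C) \<le> c' * log b (Delta X C)" "0 \<le> c'"
    and K: "0 \<le> K" "\<And>k :: nat. 1 \<le> k \<Longrightarrow> (real k)\<^sup>2 * c ^ k \<le> K * real k ^ k"
  shows "builds_representation greedy \<epsilon> X C ((2 * c' + 14 * K) * space_bound b \<epsilon> n k (Delta X C))"
proof -
  have X: "finite X" "card X = n" "X \<noteq> {}" and C: "finite C" "card C = k" "C \<noteq> {}"
    using pc by (auto simp: points_and_centers_def)
  have n: "1 \<le> n" and k: "1 \<le> k" using X C by (auto simp: Suc_le_eq card_gt_0_iff)
  define L where "L = log b (1 / \<epsilon>)"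
  define D where "D = log b (Delta X C)"
  define Y where "Y = real k * 6 ^ k * D + real k ^ k * L ^ k"
  define Z where "Z = real k + log 2 (real n)"
  define W where "W = (real k)\<^sup>2 * width g ^ k"
  define B where "B = real k + real k * (log g (Delta X C) + 1) + W"
  have Z: "1 \<le> Z" "real k \<le> Z" "real (bits n) \<le> 2 * Z" "real (bits n) \<le> Z"
  proof -
    \<comment> \<open>The summand 1 in the bound on \<open>bits n\<close> is paid for by
      \<open>1 \<le> k\<close>.\<close>
    have "0 \<le> log 2 (real n)" "1 \<le> real k" "real (bits n) \<le> 1 + log 2 (real n)"
      using k n bits_le_log by simp_all
    then show "1 \<le> Z" "real k \<le> Z" "real (bits n) \<le> 2 * Z" "real (bits n) \<le> Z"
      by (simp_all add: Z_def)
  qed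
  have "1 \<le> Delta X C" by (rule card_separated_le(2)[OF pc \<epsilon> g(1,3), of "{}"]) auto
  then have D: "0 \<le> D" using b by (simp add: D_def)
  have L: "0 \<le> L" using b \<epsilon> by (simp add: L_def)
  have W1: "real k \<le> W"
  proof -
    have "real k * (1 * 1) \<le> real k * (real k * width g ^ k)"
      using k width_ge_1[OF g(1,2)] by (intro mult_left_mono mult_mono one_le_power) auto
    then show ?thesis by (simp add: W_def power2_eq_square mult.assoc)
  qed
  have "W \<le> (real k)\<^sup>2 * (c * L) ^ k"
    unfolding W_def L_def using width width_ge_1[OF g(1,2)] by (intro mult_left_mono power_mono) auto
  also have "\<dots> = ((real k)\<^sup>2 * c ^ k) * L ^ k" by (simp add: power_mult_distrib)
  also have "\<dots> \<le> (K * real k ^ k) * L ^ k" using L by (intro mult_right_mono K k) auto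
  also have "\<dots> \<le> K * Y" using K D by (simp add: Y_def distrib_left mult.assoc)
  finally have W: "W \<le> K * Y" .
  have "real k * log g (Delta X C) \<le> real k * (c' * D)"
    using Delta by (intro mult_left_mono) (auto simp: D_def)
  also have "\<dots> \<le> c' * (real k * 6 ^ k * D)"
  proof -
    have "c' * (real k * 1 * D) \<le> c' * (real k * 6 ^ k * D)"
      using D Delta by (intro mult_left_mono mult_right_mono one_le_power) auto
    then show ?thesis by (simp add: mult_ac)
  qed
  also have "\<dots> \<le> c' * Y" using Delta L by (intro mult_left_mono) (auto simp: Y_def)
  \<comment> \<open>The factor 3 stands for \<open>W\<close> and the two summands \<open>k\<close>,
    each at most \<open>W\<close>.\<close>
  finally have B: "B \<le> (c' + 3 * K) * Y"
    using W W1 by (simp add: B_def algebra_simps)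
  have Y: "1 \<le> K * Y" using W W1 k by linarith
  define M where "M = nat \<lfloor>B\<rfloor>"
  have card_le: "card R \<le> M" if "R \<subseteq> X" "\<And>p q. p \<in> R \<Longrightarrow> q \<in> R \<Longrightarrow> p \<noteq> q \<Longrightarrow>
      \<not> (close \<epsilon> C p q \<and> close \<epsilon> C q p)" for R
    using card_separated_le(1)[OF pc \<epsilon> g(1,3) that] unfolding M_def B_def W_def
    by (simp add: le_nat_floor)
  have M: "real M \<le> (c' + 3 * K) * Y"
  proof -
    have "0 \<le> B" using card_separated_le(1)[OF pc \<epsilon> g(1,3), of "{}"] by (simp add: B_def W_def)
    then show ?thesis using B by (simp add: M_def) linarith
  qed
  have "real (space_cap n M k) = 2 * real (bits n) + 5 + real k + real M * (real (bits n) + real k)"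
    by (simp add: space_cap_def distrib_left)
  also have "\<dots> \<le> 2 * Z + 5 * Z + Z + real M * (Z + Z)"
    using Z by (intro add_mono mult_left_mono) auto
  also have "\<dots> = (8 * 1 + 2 * real M) * Z" by (simp add: algebra_simps)
  \<comment> \<open>Replacing the 1 by \<open>K * Y\<close> gives 8 + 2 * 3 = 14 as the factor of
    \<open>K\<close>.\<close>
  also have "\<dots> \<le> (8 * (K * Y) + 2 * ((c' + 3 * K) * Y)) * Z"
    using Z M Y by (intro mult_right_mono add_mono mult_left_mono) auto
  also have "\<dots> = (2 * c' + 14 * K) * (Z * Y)" by (simp add: algebra_simps)
  also have "Z * Y = space_bound b \<epsilon> n k (Delta X C)"
    by (simp add: space_bound_def Z_def Y_def L_def D_def)
  finally have cap: "real (space_cap n M k) \<le> (2 * c' + 14 * K) * space_bound b \<epsilon> n k (Delta X C)" .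
  show ?thesis
    unfolding builds_representation_def
  proof (intro allI impI)
    fix xs cs assume *: "distinct xs \<and> set xs = X \<and> distinct cs \<and> set cs = C"
    then have "length cs = k" using C distinct_card[of cs] by simp
    then interpret run \<epsilon> cs X n M k
      using \<epsilon> X k card_le * by unfold_locales auto
    obtain \<sigma> where "single_pass greedy \<epsilon> cs xs \<sigma>" "graph_in_memory cs \<sigma>"
        "represents \<epsilon> (graph_of cs \<sigma>) X C" "peak \<sigma> \<le> space_cap n M k"
      using greedy_correct[of xs] * by blast
    then show "\<exists>\<sigma>. single_pass greedy \<epsilon> cs xs \<sigma> \<and> graph_in_memory cs \<sigma> \<and>
        represents \<epsilon> (graph_of cs \<sigma>) X C \<and>
        real (peak \<sigma>) \<le> (2 * c' + 14 * K) * space_bound b \<epsilon> n k (Delta X C)"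
      using cap by (meson of_nat_le_iff order_trans)
  qed
qed

text \<open>The factor \<open>s\<close> is the cost of changing the base of the logarithms from \<open>1 + \<epsilon>\<close> to \<open>b\<close>.\<close>

lemma greedy_space:
  assumes \<epsilon>\<^sub>0: "0 < \<epsilon>\<^sub>0" "\<epsilon>\<^sub>0 < 1" and s: "0 \<le> s"
  shows "\<exists>K. \<forall>\<epsilon> b d n k X C. 0 < \<epsilon> \<and> \<epsilon> \<le> \<epsilon>\<^sub>0 \<and> 1 < b \<and>
      (\<forall>x\<ge>1. log (1 + \<epsilon>) x \<le> s * log b x) \<and> points_and_centers d n k X C \<longrightarrow>
      builds_representation greedy \<epsilon> X C (K * space_bound b \<epsilon> n k (Delta X C))"
proof -
  define c where "c = (8 * ln 90 + 1) / ln (1 / \<epsilon>\<^sub>0) + 8"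
  have c: "0 \<le> c" using \<epsilon>\<^sub>0 by (auto simp: c_def add_nonneg_nonneg)
  then have "0 \<le> c * s" using s by simp
  then obtain K where K: "0 \<le> K" "\<And>k :: nat. 1 \<le> k \<Longrightarrow> (real k)\<^sup>2 * (c * s) ^ k \<le> K * real k ^ k"
    using sq_times_power_le by blast
  show ?thesis
  \<comment> \<open>The witness has \<open>c' = 4 * s\<close>, where 4 comes from
    \<open>g ^ 4 = 1 + \<epsilon>\<close> and \<open>s\<close> from the change to base
    \<open>b\<close>.\<close>
  proof (intro exI[of _ "2 * (4 * s) + 14 * K"] allI impI, elim conjE)
    fix \<epsilon> b d n k X C
    assume \<epsilon>: "0 < \<epsilon>" "\<epsilon> \<le> \<epsilon>\<^sub>0" and b: "1 < b" and base: "\<forall>x\<ge>1. log (1 + \<epsilon>) x \<le> s * log b x"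
      and pc: "points_and_centers d n k X C"
    have \<epsilon>1: "\<epsilon> < 1" using \<epsilon> \<epsilon>\<^sub>0 by simp
    define g where "g = root 4 (1 + \<epsilon>)"
    have g: "1 < g" "g ^ 4 = 1 + \<epsilon>" using \<epsilon> by (auto simp: g_def)
    have "root 4 (1 + \<epsilon>) \<le> root 4 (2 ^ 4)" using \<epsilon>1 by (subst real_root_le_iff) auto
    then have g2: "g \<le> 2" by (simp add: g_def real_root_power_cancel)
    have log_g: "log g x = 4 * log (1 + \<epsilon>) x" for x
      unfolding g(2)[symmetric] using g(1) by (simp add: log_def ln_realpow)
    have "width g \<le> c * log (1 + \<epsilon>) (1 / \<epsilon>)"
      unfolding c_def using width_le[OF \<epsilon> \<epsilon>\<^sub>0(2) g g2] .
    also have "\<dots> \<le> c * (s * log b (1 / \<epsilon>))"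
      using base \<epsilon> \<epsilon>1 c by (intro mult_left_mono) auto
    finally have w: "width g \<le> (c * s) * log b (1 / \<epsilon>)" by simp
    have "1 \<le> Delta X C"
      by (rule card_separated_le(2)[OF pc \<epsilon>(1) \<epsilon>1 g, of "{}"]) auto
    then have D: "log g (Delta X C) \<le> (4 * s) * log b (Delta X C)"
      using base by (simp add: log_g)
    show "builds_representation greedy \<epsilon> X C
        ((2 * (4 * s) + 14 * K) * space_bound b \<epsilon> n k (Delta X C))"
      by (rule greedy_builds_representation[OF pc \<epsilon>(1) \<epsilon>1 g(1) g2 g(2) b w \<open>0 \<le> c * s\<close> D _ K])
        (use s in simp)
  qed
qed

theorem theorem6:
  shows "\<exists>A :: streaming_algorithm.
    (\<forall>\<epsilon>. 0 < \<epsilon> \<and> \<epsilon> < 1 \<longrightarrow>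
      (\<exists>K. \<forall>d n k X C. points_and_centers d n k X C \<longrightarrow>
         builds_representation A \<epsilon> X C (K * space_bound 2 \<epsilon> n k (Delta X C)))) \<and>
    (\<forall>\<epsilon>\<^sub>0. 0 < \<epsilon>\<^sub>0 \<and> \<epsilon>\<^sub>0 < 1 \<longrightarrow>
      (\<exists>K. \<forall>\<epsilon> d n k X C. 0 < \<epsilon> \<and> \<epsilon> \<le> \<epsilon>\<^sub>0 \<and> points_and_centers d n k X C \<longrightarrow>
         builds_representation A \<epsilon> X C (K * space_bound (1 + \<epsilon>) \<epsilon> n k (Delta X C))))"
proof (intro exI[of _ greedy] conjI allI impI)
  fix \<epsilon> :: real assume \<epsilon>: "0 < \<epsilon> \<and> \<epsilon> < 1"
  \<comment> \<open>For base 2 the cost of the base change depends on \<epsilon> alone, and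
    \<epsilon> is fixed before the constant, so \<epsilon> itself can serve as its upper
    bound.\<close>
  have "log (1 + \<epsilon>) x = (ln 2 / ln (1 + \<epsilon>)) * log 2 x" for x
    by (simp add: log_def)
  then have base: "\<forall>x\<ge>1. log (1 + \<epsilon>) x \<le> (ln 2 / ln (1 + \<epsilon>)) * log 2 x" by simp
  have "0 \<le> ln 2 / ln (1 + \<epsilon>)" using \<epsilon> by simp
  from greedy_space[OF _ _ this, of \<epsilon>] \<epsilon> base
  show "\<exists>K. \<forall>d n k X C. points_and_centers d n k X C \<longrightarrow>
      builds_representation greedy \<epsilon> X C (K * space_bound 2 \<epsilon> n k (Delta X C))"
    by (meson one_less_numeral_iff order_refl semiring_norm(76))
next
  fix \<epsilon>\<^sub>0 :: real assume "0 < \<epsilon>\<^sub>0 \<and> \<epsilon>\<^sub>0 < 1"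
  \<comment> \<open>For base \<open>1 + \<epsilon>\<close> the change of base is free, and one
    constant serves all \<epsilon> up to \<open>\<epsilon>\<^sub>0\<close>.\<close>
  then obtain K where "\<forall>\<epsilon> b d n k X C. 0 < \<epsilon> \<and> \<epsilon> \<le> \<epsilon>\<^sub>0 \<and> 1 < b \<and>
      (\<forall>x\<ge>1. log (1 + \<epsilon>) x \<le> 1 * log b x) \<and> points_and_centers d n k X C \<longrightarrow>
      builds_representation greedy \<epsilon> X C (K * space_bound b \<epsilon> n k (Delta X C))"
    using greedy_space[of \<epsilon>\<^sub>0 1] by auto
  then show "\<exists>K. \<forall>\<epsilon> d n k X C. 0 < \<epsilon> \<and> \<epsilon> \<le> \<epsilon>\<^sub>0 \<and> points_and_centers d n k X C \<longrightarrow>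
      builds_representation greedy \<epsilon> X C (K * space_bound (1 + \<epsilon>) \<epsilon> n k (Delta X C))"
    by (intro exI[of _ K] allI impI) auto
qed

end
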